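(* Let $\lambda$ be a Ferrers shape and let $\mathbf a=(a_1,a_2,\dots)$ be a finite sequence of positive integers. Then $$\bigl|W^{(a_1,a_2,\dots)}_\lambda(\{231,121\})\bigr|=\bigl|W^{(a_1,a_2,\dots)}_\lambda(\{312,211\})\bigr|.$$ That is, the sets of patterns $\{231,121\}$ and $\{312,211\}$ are shape-Wilf-equivalent for words.
   Context: A Ferrers shape $\lambda=(\lambda_1,\lambda_2,\dots)$ with $\lambda_1\ge\lambda_2\ge\cdots$ is drawn in French convention: a left-justified arrangement of cells with $\lambda_i$ cells in row $i$, rows numbered from bottom (row 1) to top; columns are numbered from left to right. A $0$-$1$-filling of $\lambda$ assigns $0$ or $1$ to each cell. For a word $x=x_1x_2\cdots x_r$ over the positive integers with largest letter $M$, let $M(x)$ be the $M\times r$ $0$-$1$ matrix (rows numbered bottom to top) having a $1$ in row $x_j$ of column $j$ for each $j$, and $0$ elsewhere. A filling $F$ of $\lambda$ contains $x$ if there are rows $\rho_1<\rho_2<\dots<\rho_M$ and columns $c_1<c_2<\dots<c_r$ such that every cell (row $\rho_l$, column $c_j$) lies in $\lambda$ and the entries of $F$ in these cells form exactly the matrix $M(x)$; otherwise $F$ avoids $x$. For a set $\Omega$ of words, $W^{(a_1,a_2,\dots)}_\lambda(\Omega)$ denotes the set of $0$-$1$-fillings of $\lambda$ with exactly one $1$ in each column, exactly $a_i$ ones in row $i$ for each $i$, and which avoid every word in $\Omega$. Two sets of words $\Omega,\Sigma$ are shape-Wilf-equivalent for words if $|W^{(a_1,a_2,\dots)}_\lambda(\Omega)|=|W^{(a_1,a_2,\dots)}_\lambda(\Sigma)|$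 for all finite sequences of positive integers $a_1,a_2,\dots$ and all Ferrers shapes $\lambda$. *)

theory Defs
  imports Main
begin

text \<open>A Ferrers shape is a list of row lengths, row 1 first (bottom row, French
convention), weakly decreasing, all positive.\<close>
definition ferrers :: "nat list \<Rightarrow> bool" where
  "ferrers lam \<longleftrightarrow> sorted_wrt (\<ge>) lam \<and> (\<forall>k\<in>set lam. 0 < k)"

definition cells :: "nat list \<Rightarrow> (nat \<times> nat) set" where
  "cells lam = {(i, j). 1 \<le> i \<and> i \<le> length lam \<and> 1 \<le> j \<and> j \<le> lam ! (i - 1)}"

definition ncols :: "nat list \<Rightarrow> nat" where
  "ncols lam = (if lam = [] then 0 else hd lam)"

text \<open>A 0-1 filling is represented by the set of its cells containing a 1.
  Containment of a word x (largest letter M, length r): rows rho_1<...<rho_M,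
  columns c_1<...<c_r, all cells in the shape, entries forming M(x).\<close>
definition contains :: "nat list \<Rightarrow> (nat \<times> nat) set \<Rightarrow> nat list \<Rightarrow> bool" where
  "contains lam F x \<longleftrightarrow>
     (let M = Max (set x); r = length x in
      \<exists>rho c :: nat \<Rightarrow> nat.
        strict_mono_on {1..M} rho \<and> strict_mono_on {1..r} c \<and>
        (\<forall>l\<in>{1..M}. \<forall>j\<in>{1..r}.
           (rho l, c j) \<in> cells lam \<and> ((rho l, c j) \<in> F \<longleftrightarrow> x ! (j - 1) = l)))"

definition W :: "nat list \<Rightarrow> nat list \<Rightarrow> nat list set \<Rightarrow> (nat \<times> nat) set set" where
  "W lam a Omega = {F. F \<subseteq> cells lam
      \<and> (\<forall>j\<in>{1..ncols lam}. card {i. (i, j) \<in> F} = 1)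
      \<and> (\<forall>i\<ge>1. card {j. (i, j) \<in> F} = (if i \<le> length a then a ! (i - 1) else 0))
      \<and> (\<forall>x\<in>Omega. \<not> contains lam F x)}"

end

theory Submission
  imports Defs
begin

text \<open>
  Follow the border of the shape from its top left to its bottom right corner, keeping the list
  of columns whose entry lies in a remaining row, sorted by decreasing row; ties are broken by
  increasing column for \<open>{231, 121}\<close> and by decreasing column for \<open>{312, 211}\<close>. A new column is
  inserted into the list, and a completed row of multiplicity \<open>a\<close> removes the first \<open>a\<close> entries,
  which have to be sorted by the tie order. For \<open>{231, 121}\<close> an insertion is legal iff the entries
  in front of the new one are increasing; for \<open>{312, 211}\<close> iff they all exceed the entries behind it.

  The number of ways to continue depends only on the lengths of the maximal descending (resp.
  ascending) runs of the list, written as \<open>q\<^sub>1, q\<^sub>2, \<dots>\<close> with \<open>q\<^sub>i\<close> the length minus one, and in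
  the second case also on which runs are alive, that is, end in an entry exceeding all later ones.
  Inserting a column either adds a new run of length one in front or lengthens a run: in the first
  case any run not preceded by a positive \<open>q\<^sub>j\<close>, in the second case any alive run, after which all
  runs in front of it are dead. Both processes are now compared with a third one on lists \<open>x\<close> in
  which only the first entry can be increased and a removed entry is added to the next one. For
  a fixed history of that process, each \<open>q\<close> whose partial sums are at most those of \<open>x\<close>, with
  equality in total, is reached exactly once in either case; the alive runs are those at which
  the partial sums agree.
\<close>

section \<open>Run length processes\<close>

text \<open>\<open>U d\<close> adds column \<open>d\<close>, \<open>E\<close> removes the first entry, and \<open>Z\<close> removes the first entry provided
  that it precedes its successor in the tie order.\<close>
datatype step = U nat | Z | E

text \<open>A positive entry that has no next one to be added to must not be removed.\<close>
fun count_det :: "step list \<Rightarrow> nat list \<Rightarrow> nat" where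
  "count_det [] x = of_bool (x = [])"
| "count_det (U d # Q) x = count_det Q (0 # x) +
    (case x of [] \<Rightarrow> 0 | y # x' \<Rightarrow> count_det Q (Suc y # x'))"
| "count_det (Z # Q) x = (case x of [] \<Rightarrow> 0 | y # x' \<Rightarrow>
    (case x' of [] \<Rightarrow> if y = 0 then count_det Q [] else 0
     | z # x'' \<Rightarrow> count_det Q ((z + y) # x'')))"
| "count_det (E # Q) x = (case x of [] \<Rightarrow> 0 | y # x' \<Rightarrow>
    (case x' of [] \<Rightarrow> if y = 0 then count_det Q [] else 0
     | z # x'' \<Rightarrow> count_det Q ((z + y) # x''))
    + (case y of 0 \<Rightarrow> 0 | Suc k \<Rightarrow> count_det Q (k # x')))"

fun bumps :: "nat list \<Rightarrow> nat list list" where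
  "bumps [] = []"
| "bumps (k # q) = (Suc k # q) # (if k = 0 then map ((#) 0) (bumps q) else [])"

text \<open>\<open>Z\<close> demands that the first entry precede its successor in the tie order,
  which makes it a run of its own; \<open>E\<close> makes no such demand and may merely shorten a
  longer run.\<close>

fun count_runs :: "step list \<Rightarrow> nat list \<Rightarrow> nat" where
  "count_runs [] q = of_bool (q = [])"
| "count_runs (U d # Q) q = count_runs Q (0 # q) + sum_list (map (count_runs Q) (bumps q))"
| "count_runs (Z # Q) q = (case q of [] \<Rightarrow> 0
    | k # q' \<Rightarrow> if k = 0 then count_runs Q q' else 0)"
| "count_runs (E # Q) q = (case q of [] \<Rightarrow> 0
    | k # q' \<Rightarrow> (case k of 0 \<Rightarrow> count_runs Q q' | Suc l \<Rightarrow> count_runs Q (l # q')))"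

text \<open>The inserted column exceeds all others, so every run in front of the one that it joins
  loses its flag, while that run and those behind it keep theirs.\<close>

fun bumps_alive :: "(nat \<times> bool) list \<Rightarrow> (nat \<times> bool) list list" where
  "bumps_alive [] = []"
| "bumps_alive ((k, f) # s) =
    (if f then [(Suc k, f) # s] else []) @ map ((#) (k, False)) (bumps_alive s)"

fun count_alive :: "step list \<Rightarrow> (nat \<times> bool) list \<Rightarrow> nat" where
  "count_alive [] s = of_bool (s = [])"
| "count_alive (U d # Q) s =
    count_alive Q ((0, True) # s) + sum_list (map (count_alive Q) (bumps_alive s))"
| "count_alive (Z # Q) s = (case s of [] \<Rightarrow> 0
    | p # s' \<Rightarrow> if fst p = 0 then count_alive Q s' else 0)"
| "count_alive (E # Q) s = (case s of [] \<Rightarrow> 0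
    | p # s' \<Rightarrow> (case fst p of 0 \<Rightarrow> count_alive Q s' | Suc l \<Rightarrow> count_alive Q ((l, snd p) # s')))"

text \<open>The sum of \<open>f\<close> over all lists whose partial sums are at most those of the given list, with
  equality for the total: what the first entry leaves unused is passed on to the next one.\<close>
fun dom_sum :: "nat list \<Rightarrow> (nat list \<Rightarrow> nat) \<Rightarrow> nat" where
  "dom_sum [] f = f []"
| "dom_sum [y] f = f [y]"
| "dom_sum (y # z # x) f = (\<Sum>k\<le>y. dom_sum ((z + (y - k)) # x) (\<lambda>q. f (k # q)))"

text \<open>The flag \<open>k = y\<close> says that nothing is passed on, that is, the partial sums
  up to this entry agree. The last flag is set because the totals agree.\<close>

fun dom_sum_alive :: "nat list \<Rightarrow> ((nat \<times> bool) list \<Rightarrow> nat) \<Rightarrow> nat" where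
  "dom_sum_alive [] f = f []"
| "dom_sum_alive [y] f = f [(y, True)]"
| "dom_sum_alive (y # z # x) f =
    (\<Sum>k\<le>y. dom_sum_alive ((z + (y - k)) # x) (\<lambda>s. f ((k, k = y) # s)))"

section \<open>Comparison of both run length processes with \<open>count_det\<close>\<close>

lemma dom_sum_add: "dom_sum x (\<lambda>q. f q + g q) = dom_sum x f + dom_sum x g"
  by (induction x f arbitrary: g rule: dom_sum.induct) (simp_all add: sum.distrib)

lemma dom_sum_zero [simp]: "dom_sum x (\<lambda>q. 0) = 0"
  by (induction x "\<lambda>q::nat list. 0::nat" rule: dom_sum.induct) simp_all

lemma dom_sum_alive_add:
  "dom_sum_alive x (\<lambda>q. f q + g q) = dom_sum_alive x f + dom_sum_alive x g"
  by (induction x f arbitrary: g rule: dom_sum_alive.induct) (simp_all add: sum.distrib)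

lemma dom_sum_alive_zero [simp]: "dom_sum_alive x (\<lambda>q. 0) = 0"
  by (induction x "\<lambda>q::(nat \<times> bool) list. 0::nat" rule: dom_sum_alive.induct) simp_all

lemma dom_sum_Cons_0: "dom_sum (0 # x) f = dom_sum x (\<lambda>q. f (0 # q))"
  by (cases x) simp_all

lemma dom_sum_alive_Cons_0: "dom_sum_alive (0 # x) f = dom_sum_alive x (\<lambda>q. f ((0, True) # q))"
  by (cases x) simp_all

text \<open>Only zeros precede the raised entry, so it is the first positive one afterwards.
  Conversely, lowering the first positive entry of a list dominated by \<open>Suc y # x\<close>
  gives a list dominated by \<open>y # x\<close>. Hence each such list is reached exactly
  once.\<close>

lemma dom_sum_bumps:
  "dom_sum (y # x) (\<lambda>q. sum_list (map f (bumps q))) = dom_sum (Suc y # x) f"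
proof (induction x arbitrary: y f)
  case Nil
  then show ?case by simp
next
  case (Cons z x)
  \<comment> \<open>The rest can be bumped only behind \<open>k = 0\<close>; there all of
    \<open>y\<close> has been passed on, and the induction hypothesis turns \<open>z + y\<close>
    into \<open>z + Suc y\<close>.\<close>
  have 1: "dom_sum ((z + (y - k)) # x) (\<lambda>q. sum_list (map f (bumps (k # q)))) =
      dom_sum ((z + (y - k)) # x) (\<lambda>q. f (Suc k # q)) +
      (if k = 0 then dom_sum ((z + Suc y) # x) (\<lambda>q. f (0 # q)) else 0)" for k
    by (cases "k = 0") (simp_all add: dom_sum_add Cons.IH[of _ "\<lambda>q. f (0 # q)", symmetric] comp_def)
  \<comment> \<open>Bumps of the first entry supply the summands with positive first entry on the
    right, bumps of the rest the summand for 0.\<close>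
  show ?case
    by (simp only: dom_sum.simps 1 sum.distrib sum.atMost_Suc_shift)
      (simp add: sum.delta)
qed

text \<open>The raised run is the first alive one of the new list: before it the bound has grown by
  one but the partial sums have not, and from it on both have. Conversely, the entry at the first
  alive run is positive and can be lowered, so each list is reached exactly once.\<close>

lemma dom_sum_alive_bumps_alive:
  "dom_sum_alive (y # x) (\<lambda>q. sum_list (map f (bumps_alive q))) = dom_sum_alive (Suc y # x) f"
proof (induction x arbitrary: y f)
  case Nil
  then show ?case by simp
next
  case (Cons z x)
  \<comment> \<open>An alive first run (\<open>k = y\<close>) can be raised itself, which becomes
    the summand \<open>Suc y\<close> on the right. Otherwise the first run dies, and the excess
    \<open>y - k\<close> that is passed on grows by one.\<close>
  have 1: "dom_sum_alive ((z + (y - k)) # x)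
        (\<lambda>q. sum_list (map f (bumps_alive ((k, k = y) # q)))) =
      (if k = y then dom_sum_alive (z # x) (\<lambda>q. f ((Suc y, True) # q)) else 0) +
      dom_sum_alive ((z + (Suc y - k)) # x) (\<lambda>q. f ((k, k = Suc y) # q))" if "k \<le> y" for k
    using that Cons.IH[of "z + (y - k)" "\<lambda>q. f ((k, False) # q)"]
    by (cases "k = y") (simp_all add: dom_sum_alive_add comp_def Suc_diff_le)
  have "dom_sum_alive (y # z # x) (\<lambda>q. sum_list (map f (bumps_alive q))) =
      (\<Sum>k\<le>y. (if k = y then dom_sum_alive (z # x) (\<lambda>q. f ((Suc y, True) # q)) else 0) +
      dom_sum_alive ((z + (Suc y - k)) # x) (\<lambda>q. f ((k, k = Suc y) # q)))"
    unfolding dom_sum_alive.simps by (intro sum.cong refl 1) simp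
  then show ?case
    by (simp add: sum.distrib)
qed

text \<open>Splitting by the first entry \<open>k\<close> of the dominated list yields the clauses
  of \<open>count_det\<close>: \<open>Z\<close> keeps only \<open>k = 0\<close>, where all of
  \<open>y\<close> is passed on, and the two summands for \<open>E\<close> belong to
  \<open>k = 0\<close> and \<open>k > 0\<close>.\<close>

lemma dom_sum_count_runs: "dom_sum x (count_runs Q) = count_det Q x"
proof (induction Q arbitrary: x)
  case Nil
  show ?case
    by (cases "(x, \<lambda>q::nat list. 0::nat)" rule: dom_sum.cases) auto
next
  case (Cons s Q)
  show ?case
  proof (cases s)
    case (U d)
    have "dom_sum x (\<lambda>q. count_runs Q (0 # q)) = count_det Q (0 # x)"
      using Cons.IH[of "0 # x"] unfolding dom_sum_Cons_0 .
    with U show ?thesis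
      by (cases x) (simp_all add: dom_sum_add dom_sum_bumps Cons.IH)
  next
    case Z
    show ?thesis
    proof (cases "(x, \<lambda>q::nat list. 0::nat)" rule: dom_sum.cases)
      case (3 y z x' f)
      have "dom_sum ((z + (y - k)) # x') (\<lambda>q. count_runs (Z # Q) (k # q)) =
          (if k = 0 then dom_sum ((z + y) # x') (count_runs Q) else 0)" for k
        by (cases "k = 0") simp_all
      then show ?thesis using 3 Z Cons.IH by (simp add: sum.delta del: count_runs.simps Nat.add_diff_assoc)
    qed (use Cons.IH[of "[]"] Z in auto)
  next
    case E
    show ?thesis
    proof (cases "(x, \<lambda>q::nat list. 0::nat)" rule: dom_sum.cases)
      case (2 y f)
      then show ?thesis using E Cons.IH[of "[]"] Cons.IH[of "[y - 1]"] by (auto split: nat.split)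
    next
      case (3 y z x' f)
      have "dom_sum x (\<lambda>q. count_runs (E # Q) q) =
         dom_sum ((z + y) # x') (count_runs Q) +
         (case y of 0 \<Rightarrow> 0 | Suc k \<Rightarrow> dom_sum (k # z # x') (count_runs Q))"
        using 3 by (cases y) (simp_all add: sum.atMost_Suc_shift del: sum.atMost_Suc)
      then show ?thesis using 3 Cons.IH E by (simp split: nat.split)
    qed (use E in auto)
  qed
qed

text \<open>The same split works with flags, since lowering both \<open>k\<close> and
  \<open>y\<close> by one does not affect whether \<open>k = y\<close>.\<close>

lemma dom_sum_alive_count_alive: "dom_sum_alive x (count_alive Q) = count_det Q x"
proof (induction Q arbitrary: x)
  case Nil
  show ?case
    by (cases "(x, \<lambda>q::(nat \<times> bool) list. 0::nat)" rule: dom_sum_alive.cases) auto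
next
  case (Cons s Q)
  show ?case
  proof (cases s)
    case (U d)
    have "dom_sum_alive x (\<lambda>q. count_alive Q ((0, True) # q)) = count_det Q (0 # x)"
      using Cons.IH[of "0 # x"] unfolding dom_sum_alive_Cons_0 .
    with U show ?thesis
      by (cases x) (simp_all add: dom_sum_alive_add dom_sum_alive_bumps_alive Cons.IH)
  next
    case Z
    show ?thesis
    proof (cases "(x, \<lambda>q::(nat \<times> bool) list. 0::nat)" rule: dom_sum_alive.cases)
      case (3 y z x' f)
      have "dom_sum_alive ((z + (y - k)) # x') (\<lambda>q. count_alive (Z # Q) ((k, k = y) # q)) =
          (if k = 0 then dom_sum_alive ((z + y) # x') (count_alive Q) else 0)" for k
        by (cases "k = 0") simp_all
      then show ?thesis using 3 Z Cons.IH by (simp add: sum.delta del: count_alive.simps Nat.add_diff_assoc)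
    qed (use Cons.IH[of "[]"] Z in auto)
  next
    case E
    show ?thesis
    proof (cases "(x, \<lambda>q::(nat \<times> bool) list. 0::nat)" rule: dom_sum_alive.cases)
      case (2 y f)
      then show ?thesis using E Cons.IH[of "[]"] Cons.IH[of "[y - 1]"] by (auto split: nat.split)
    next
      case (3 y z x' f)
      have "dom_sum_alive x (\<lambda>q. count_alive (E # Q) q) =
         dom_sum_alive ((z + y) # x') (count_alive Q) +
         (case y of 0 \<Rightarrow> 0 | Suc k \<Rightarrow> dom_sum_alive (k # z # x') (count_alive Q))"
        using 3 by (cases y) (simp_all add: sum.atMost_Suc_shift del: sum.atMost_Suc)
      then show ?thesis using 3 Cons.IH E by (simp split: nat.split)
    qed (use E in auto)
  qed
qed

corollary count_runs_eq_count_alive: "count_runs Q [] = count_alive Q []"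
  using dom_sum_count_runs[of "[]" Q] dom_sum_alive_count_alive[of "[]" Q] by simp

section \<open>Insertion processes\<close>

text \<open>\<open>ok j L\<close> is the legality of inserting at position \<open>j\<close>. Only
  histories ending with the empty list count: no column may be left without a row.\<close>

fun count_ins :: "(nat \<Rightarrow> nat \<Rightarrow> bool) \<Rightarrow> (nat \<Rightarrow> nat list \<Rightarrow> bool) \<Rightarrow> step list \<Rightarrow> nat list \<Rightarrow> nat" where
  "count_ins tie ok [] L = of_bool (L = [])"
| "count_ins tie ok (U d # Q) L =
    (\<Sum>j | j \<le> length L \<and> ok j L. count_ins tie ok Q (take j L @ d # drop j L))"
| "count_ins tie ok (Z # Q) L = (case L of [] \<Rightarrow> 0
    | x # L' \<Rightarrow> if L' = [] \<or> tie x (hd L') then count_ins tie ok Q L' else 0)"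
| "count_ins tie ok (E # Q) L = (case L of [] \<Rightarrow> 0 | x # L' \<Rightarrow> count_ins tie ok Q L')"

definition ok231 :: "nat \<Rightarrow> nat list \<Rightarrow> bool" where
  "ok231 j L \<longleftrightarrow> sorted_wrt (<) (take j L)"

definition ok312 :: "nat \<Rightarrow> nat list \<Rightarrow> bool" where
  "ok312 j L \<longleftrightarrow> (\<forall>x\<in>set (take j L). \<forall>y\<in>set (drop j L). y < x)"

fun fresh :: "nat list \<Rightarrow> step list \<Rightarrow> bool" where
  "fresh L [] = True"
| "fresh L (U d # Q) \<longleftrightarrow> (\<forall>x\<in>set L. x < d) \<and> fresh (d # L) Q"
| "fresh L (_ # Q) \<longleftrightarrow> fresh L Q"

lemma fresh_antimono: "fresh L Q \<Longrightarrow> set L' \<subseteq> set L \<Longrightarrow> fresh L' Q"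
proof (induction Q arbitrary: L L')
  case (Cons s Q)
  then show ?case
    by (cases s) (auto, metis insert_mono list.simps(15))
qed simp

section \<open>Legal insertions for 231 and 121 in terms of descending runs\<close>

fun inc_hd :: "nat list \<Rightarrow> nat list" where
  "inc_hd [] = []"
| "inc_hd (k # q) = Suc k # q"

text \<open>Lengths minus one of the maximal descending runs.\<close>
fun descents :: "nat list \<Rightarrow> nat list" where
  "descents [] = []"
| "descents [x] = [0]"
| "descents (x # y # L) =
    (if x < y then 0 # descents (y # L) else inc_hd (descents (y # L)))"

lemma descents_eq_Nil [simp]: "descents L = [] \<longleftrightarrow> L = []"
proof (induction L rule: descents.induct)
  case (3 x y L)
  then show ?case by (cases "descents (y # L)") auto
qed auto

lemma sum_le_Suc_shift:
  fixes f :: "nat \<Rightarrow> 'a :: comm_monoid_add"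
  shows "(\<Sum>j | j \<le> Suc n \<and> P j. f j) =
    (if P 0 then f 0 else 0) + (\<Sum>j | j \<le> n \<and> P (Suc j). f (Suc j))"
proof -
  have "{j. j \<le> Suc n \<and> P j} = (if P 0 then {0} else {}) \<union> Suc ` {j. j \<le> n \<and> P (Suc j)}"
    by (auto simp: image_iff split: if_splits) (metis Suc_le_mono not0_implies_Suc)+
  then show ?thesis
    by (auto simp: sum.union_disjoint sum.reindex)
qed

text \<open>The legal positions are those in or right after the longest increasing prefix. Before an
  entry of this prefix, \<open>d\<close> joins the run that starts there, which is a bump. After its
  last entry, \<open>d\<close> takes the place of that entry in its run, and the entry is split off
  as a run of length one; as all runs in front have length one too, this amounts to a new 0 at the
  head.\<close>

lemma sum_ok231:
  assumes "\<forall>x\<in>set L. x < d"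
  shows "(\<Sum>j | j \<le> length L \<and> ok231 j L. h (descents (take j L @ d # drop j L))) =
    h (0 # descents L) + sum_list (map h (bumps (descents L)))"
  using assms
proof (induction L arbitrary: h)
  case Nil
  have "{j. j = 0 \<and> ok231 j []} = {0}" by (auto simp: ok231_def)
  then show ?case by simp
next
  case (Cons x L)
  show ?case
  proof (cases L)
    case Nil
    then show ?thesis
      using Cons.prems by (auto simp: ok231_def atMost_def[symmetric] atMost_Suc)
  next
    case (Cons y L')
    have xd: "x < d" "y < d" using Cons.prems Cons by auto
    have split: "(\<Sum>j | j \<le> length (x # L) \<and> ok231 j (x # L).
        h (descents (take j (x # L) @ d # drop j (x # L)))) = h (descents (d # x # L)) +
       (\<Sum>j | j \<le> length L \<and> ok231 (Suc j) (x # L). h (descents (x # take j L @ d # drop j L)))"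
      by (simp add: sum_le_Suc_shift) (simp add: ok231_def)
    show ?thesis
    proof (cases "x < y")
      case True
      have ok: "ok231 (Suc j) (x # L) \<longleftrightarrow> ok231 j L" for j
        using True Cons by (cases j) (auto simp: ok231_def)
      have d: "descents (x # take j L @ d # drop j L) = 0 # descents (take j L @ d # drop j L)" for j
        using True xd Cons by (cases j) auto
      show ?thesis
        unfolding split ok d
        using Cons.IH[of "\<lambda>q. h (0 # q)"] Cons.prems True xd Cons by (simp add: comp_def add_ac)
    next
      case False
      \<comment> \<open>Here \<open>d\<close> can go only right before or right after
        \<open>x\<close>; in the second case \<open>x\<close> is split off and \<open>d\<close>
        replaces it in its run.\<close>
      have ok: "ok231 (Suc j) (x # L) \<longleftrightarrow> j = 0" for j
        using False Cons by (cases j) (auto simp: ok231_def)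
      have s: "{j. j \<le> length L \<and> j = 0} = {0}" by auto
      obtain k q where "descents (y # L') = k # q"
        by (cases "descents (y # L')") auto
      then show ?thesis
        unfolding split ok s using False xd Cons by (simp add: add_ac)
    qed
  qed
qed

lemma count_ins_231:
  assumes "fresh L Q" "distinct L"
  shows "count_ins (<) ok231 Q L = count_runs Q (descents L)"
  using assms
proof (induction Q arbitrary: L)
  case Nil
  then show ?case by simp
next
  case (Cons s Q)
  show ?case
  proof (cases s)
    case (U d)
    have "count_ins (<) ok231 Q (take j L @ d # drop j L) =
        count_runs Q (descents (take j L @ d # drop j L))" for j
    proof (rule Cons.IH)
      show "fresh (take j L @ d # drop j L) Q"
        using Cons.prems U by (auto elim!: fresh_antimono dest: in_set_takeD in_set_dropD)
      show "distinct (take j L @ d # drop j L)"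
        using Cons.prems U
        by (auto simp: set_take_disj_set_drop_if_distinct dest: in_set_takeD in_set_dropD)
    qed
    then show ?thesis
      using U sum_ok231[of L d "count_runs Q"] Cons.prems by simp
  next
    case Z
    show ?thesis
    proof (cases L rule: descents.cases)
      case (3 x y L')
      then show ?thesis
        using Z Cons.IH[of "y # L'"] Cons.prems fresh_antimono[of L Q "y # L'"]
        by (cases "descents (y # L')") auto
    qed (use Z Cons.IH[of "[]"] Cons.prems fresh_antimono[of L Q "[]"] in auto)
  next
    case E
    show ?thesis
    proof (cases L rule: descents.cases)
      case (3 x y L')
      then show ?thesis
        using E Cons.IH[of "y # L'"] Cons.prems fresh_antimono[of L Q "y # L'"]
        by (cases "descents (y # L')") auto
    qed (use E Cons.IH[of "[]"] Cons.prems fresh_antimono[of L Q "[]"] in auto)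
  qed
qed

section \<open>Legal insertions for 312 and 211 in terms of ascending runs\<close>

fun inc_hd_alive :: "(nat \<times> bool) list \<Rightarrow> (nat \<times> bool) list" where
  "inc_hd_alive [] = []"
| "inc_hd_alive ((k, f) # q) = (Suc k, f) # q"

text \<open>Lengths minus one of the maximal ascending runs, together with the information whether the
  last entry of the run exceeds all later ones.\<close>
fun ascents :: "nat list \<Rightarrow> (nat \<times> bool) list" where
  "ascents [] = []"
| "ascents [x] = [(0, True)]"
| "ascents (x # y # L) =
    (if y < x then (0, \<forall>z\<in>set (y # L). z < x) # ascents (y # L)
     else inc_hd_alive (ascents (y # L)))"

lemma ascents_eq_Nil [simp]: "ascents L = [] \<longleftrightarrow> L = []"
proof (induction L rule: ascents.induct)
  case (3 x y L)
  then show ?case by (cases "ascents (y # L)") auto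
qed auto

lemma ascents_max: "\<forall>x\<in>set L. x < d \<Longrightarrow> ascents (d # L) = (0, True) # ascents L"
  by (cases L) auto

fun avoids132 :: "nat list \<Rightarrow> bool" where
  "avoids132 [] = True"
| "avoids132 (x # L) \<longleftrightarrow> avoids132 L \<and> sorted_wrt (\<lambda>y z. \<not> (x < z \<and> z < y)) L"

text \<open>As the maximum, \<open>d\<close> could only be the 3 of a new pattern 132, with the 1 in
  \<open>P\<close> and the 2 in \<open>S\<close>; but \<open>P\<close> lies above
  \<open>S\<close>.\<close>

lemma avoids132_insert:
  assumes "avoids132 (P @ S)" "\<forall>x\<in>set (P @ S). x < d" "\<forall>x\<in>set P. \<forall>y\<in>set S. y < x"
  shows "avoids132 (P @ d # S)"
  using assms
proof (induction P)
  case Nil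
  have "\<not> d < z" if "z \<in> set S" for z using Nil that by fastforce
  then have "sorted_wrt (\<lambda>y z. \<not> (d < z \<and> z < y)) S"
    by (simp add: sorted_wrt_iff_nth_less)
  with Nil show ?case by simp
next
  case (Cons x P)
  have "\<not> d < y" if "y \<in> set P" for y using Cons.prems(2) that by (auto simp: not_less less_imp_le)
  moreover have "\<not> x < z" if "z \<in> set S" for z using Cons.prems(3) that by (auto simp: not_less less_imp_le)
  moreover have "avoids132 (P @ d # S)" using Cons by simp
  ultimately show ?case using Cons.prems(1) by (simp add: sorted_wrt_append)
qed

lemma avoids132_middle:
  assumes "avoids132 (P @ b # S)" "x \<in> set P" "y \<in> set S"
  shows "\<not> (x < y \<and> y < b)"
  using assms by (induction P) (auto simp: sorted_wrt_append)

text \<open>Avoidance of 132 makes legality of an insertion a condition on the preceding entry and the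
  later ones only, so that removing entries at the front does not create legal positions.\<close>
lemma ok312_Suc:
  assumes "avoids132 L" "distinct L" "i < length L"
  shows "ok312 (Suc i) L \<longleftrightarrow> (\<forall>y\<in>set (drop (Suc i) L). y < L ! i)"
proof
  assume *: "\<forall>y\<in>set (drop (Suc i) L). y < L ! i"
  have L: "L = take i L @ L ! i # drop (Suc i) L"
    using assms(3) by (simp add: id_take_nth_drop)
  have "y < x" if "x \<in> set (take i L)" "y \<in> set (drop (Suc i) L)" for x y
  proof -
    have "\<not> (x < y \<and> y < L ! i)"
      using avoids132_middle[of "take i L" "L ! i" "drop (Suc i) L" x y] L assms that by metis
    moreover have "x \<noteq> y"
      using that assms(2) set_take_disj_set_drop_if_distinct[of L i "Suc i"] by auto
    ultimately show ?thesis using * that by force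
  qed
  with * show "ok312 (Suc i) L"
    using assms(3) by (auto simp: ok312_def take_Suc_conv_app_nth)
next
  assume "ok312 (Suc i) L"
  then show "\<forall>y\<in>set (drop (Suc i) L). y < L ! i"
    using assms(3) by (auto simp: ok312_def take_Suc_conv_app_nth)
qed

lemma bumps_alive_inc_hd:
  "s \<noteq> [] \<Longrightarrow> bumps_alive (inc_hd_alive s) = map inc_hd_alive (bumps_alive s)"
  by (cases s rule: inc_hd_alive.cases) auto

lemma sum_less_Suc_shift:
  fixes f :: "nat \<Rightarrow> 'a :: comm_monoid_add"
  shows "(\<Sum>j | j < Suc n \<and> P j. f j) =
    (if P 0 then f 0 else 0) + (\<Sum>j | j < n \<and> P (Suc j). f (Suc j))"
proof -
  have "{j. j < Suc n \<and> P j} = (if P 0 then {0} else {}) \<union> Suc ` {j. j < n \<and> P (Suc j)}"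
    by (auto simp: image_iff split: if_splits) (metis Suc_less_eq not0_implies_Suc)+
  then show ?thesis
    by (auto simp: sum.union_disjoint sum.reindex)
qed

text \<open>An entry exceeding all later ones ends its ascending run, so these entries correspond to
  the alive runs. Behind such an entry, \<open>d\<close> lengthens the run and exceeds the ends of
  all runs in front, which are dead from then on.\<close>

lemma sum_right_maxima:
  assumes "\<forall>x\<in>set L. x < d" "distinct L"
  shows "(\<Sum>i | i < length L \<and> (\<forall>y\<in>set (drop (Suc i) L). y < L ! i).
      h (ascents (take (Suc i) L @ d # drop (Suc i) L))) =
    sum_list (map h (bumps_alive (ascents L)))"
  using assms
proof (induction L arbitrary: h)
  case Nil
  then show ?case by simp
next
  case (Cons x L)
  have asc: "ascents (d # L) = (0, True) # ascents L"
    using Cons.prems by (intro ascents_max) auto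
  have split: "(\<Sum>i | i < length (x # L) \<and> (\<forall>y\<in>set (drop (Suc i) (x # L)). y < (x # L) ! i).
      h (ascents (take (Suc i) (x # L) @ d # drop (Suc i) (x # L)))) =
      (if \<forall>y\<in>set L. y < x then h (ascents (x # d # L)) else 0) +
      (\<Sum>i | i < length L \<and> (\<forall>y\<in>set (drop (Suc i) L). y < L ! i).
      h (ascents (x # take (Suc i) L @ d # drop (Suc i) L)))"
    by (simp only: length_Cons sum_less_Suc_shift) simp
  show ?case
  proof (cases L)
    case Nil
    then show ?thesis using Cons.prems by (simp add: sum_less_Suc_shift)
  next
    case L: (Cons y L')
    have xd: "x < d" "y < d" "x \<noteq> y" using Cons.prems L by auto
    show ?thesis
    proof (cases "y < x")
      case True
      have d: "ascents (x # take (Suc i) L @ d # drop (Suc i) L) =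
          (0, False) # ascents (take (Suc i) L @ d # drop (Suc i) L)" for i
        using True xd L by auto
      show ?thesis
        unfolding split d
        using Cons.IH[of "\<lambda>q. h ((0, False) # q)"] Cons.prems True xd asc L
        by (auto simp add: comp_def)
    next
      case False
      have d: "ascents (x # take (Suc i) L @ d # drop (Suc i) L) =
          inc_hd_alive (ascents (take (Suc i) L @ d # drop (Suc i) L))" for i
        using False xd L by auto
      have "\<not> (\<forall>z\<in>set L. z < x)" using False L by auto
      then show ?thesis
        unfolding split d
        using Cons.IH[of "\<lambda>q. h (inc_hd_alive q)"] Cons.prems False xd asc L
          bumps_alive_inc_hd[of "ascents L"]
        by (simp add: comp_def)
    qed
  qed
qed

text \<open>Position 0 opens a new run, as \<open>d\<close> exceeds its successor. By avoidance of
  132, the other legal positions are those right after an entry that exceeds all later ones.\<close>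

lemma sum_ok312:
  assumes "\<forall>x\<in>set L. x < d" "distinct L" "avoids132 L"
  shows "(\<Sum>j | j \<le> length L \<and> ok312 j L. h (ascents (take j L @ d # drop j L))) =
    h ((0, True) # ascents L) + sum_list (map h (bumps_alive (ascents L)))"
proof -
  have "{j. j \<le> length L \<and> ok312 j L} = insert 0 (Suc ` {i. i < length L \<and> ok312 (Suc i) L})"
    by (auto simp: image_iff ok312_def) (metis Suc_le_eq not0_implies_Suc)
  then have "(\<Sum>j | j \<le> length L \<and> ok312 j L. h (ascents (take j L @ d # drop j L))) =
      h (ascents (d # L)) + (\<Sum>i | i < length L \<and> ok312 (Suc i) L.
        h (ascents (take (Suc i) L @ d # drop (Suc i) L)))"
    by (simp add: sum.reindex)
  also have "{i. i < length L \<and> ok312 (Suc i) L} =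
      {i. i < length L \<and> (\<forall>y\<in>set (drop (Suc i) L). y < L ! i)}"
    using assms ok312_Suc by auto
  finally show ?thesis
    using sum_right_maxima[of L d h] assms ascents_max[of L d] by simp
qed

lemma count_ins_312:
  assumes "fresh L Q" "distinct L" "avoids132 L"
  shows "count_ins (>) ok312 Q L = count_alive Q (ascents L)"
  using assms
proof (induction Q arbitrary: L)
  case Nil
  then show ?case by simp
next
  case (Cons s Q)
  show ?case
  proof (cases s)
    case (U d)
    \<comment> \<open>Avoidance of 132 is preserved by legal insertions, hence the premise
      \<open>ok312 j L\<close>.\<close>
    have "count_ins (>) ok312 Q (take j L @ d # drop j L) =
        count_alive Q (ascents (take j L @ d # drop j L))" if "ok312 j L" for j
    proof (rule Cons.IH)
      show "fresh (take j L @ d # drop j L) Q"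
        using Cons.prems U by (auto elim!: fresh_antimono dest: in_set_takeD in_set_dropD)
      show "distinct (take j L @ d # drop j L)"
        using Cons.prems U
        by (auto simp: set_take_disj_set_drop_if_distinct dest: in_set_takeD in_set_dropD)
      show "avoids132 (take j L @ d # drop j L)"
        using Cons.prems U that
        by (intro avoids132_insert) (auto simp: ok312_def dest: in_set_takeD in_set_dropD)
    qed
    then show ?thesis
      using U sum_ok312[of L d "count_alive Q"] Cons.prems by simp
  next
    case Z
    show ?thesis
    proof (cases L rule: ascents.cases)
      case (3 x y L')
      then show ?thesis
        using Z Cons.IH[of "y # L'"] Cons.prems fresh_antimono[of L Q "y # L'"]
        by (cases "ascents (y # L')" rule: inc_hd_alive.cases) auto
    qed (use Z Cons.IH[of "[]"] Cons.prems fresh_antimono[of L Q "[]"] in auto)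
  next
    case E
    show ?thesis
    proof (cases L rule: ascents.cases)
      case (3 x y L')
      then show ?thesis
        using E Cons.IH[of "y # L'"] Cons.prems fresh_antimono[of L Q "y # L'"]
        by (cases "ascents (y # L')" rule: inc_hd_alive.cases) auto
    qed (use E Cons.IH[of "[]"] Cons.prems fresh_antimono[of L Q "[]"] in auto)
  qed
qed

corollary count_ins_231_eq_312:
  assumes "fresh [] Q"
  shows "count_ins (<) ok231 Q [] = count_ins (>) ok312 Q []"
  using assms by (simp add: count_ins_231 count_ins_312 count_runs_eq_count_alive)

section \<open>Scanning the border\<close>

definition above :: "(nat \<Rightarrow> nat \<Rightarrow> bool) \<Rightarrow> (nat \<Rightarrow> nat) \<Rightarrow> nat \<Rightarrow> nat \<Rightarrow> bool" where
  "above tie g x y \<longleftrightarrow> g y < g x \<or> g x = g y \<and> tie x y"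

text \<open>Sortedness of \<open>Suc a\<close> entries needs \<open>a\<close> comparisons of
  neighbours. The last removal is \<open>E\<close>, since the next entry belongs to a lower row and
  need not follow in the tie order.\<close>

fun remove_row :: "nat \<Rightarrow> step list" where
  "remove_row 0 = []"
| "remove_row (Suc a) = replicate a Z @ [E]"

lemma count_ins_remove_row:
  assumes "transp tie"
  shows "count_ins tie ok (remove_row a @ Q) L =
    (if a \<le> length L \<and> sorted_wrt tie (take a L) then count_ins tie ok Q (drop a L) else 0)"
proof (cases a)
  case (Suc m)
  have "count_ins tie ok (replicate m Z @ E # Q) L =
    (if Suc m \<le> length L \<and> sorted_wrt tie (take (Suc m) L) then count_ins tie ok Q (drop (Suc m) L) else 0)"
  proof (induction m arbitrary: L)
    case 0
    then show ?case by (cases L) auto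
  next
    case (Suc m)
    show ?case
    proof (cases L)
      case (Cons x L')
      show ?thesis
      proof (cases L')
        case Nil
        then show ?thesis using Suc Cons by simp
      next
        case L': (Cons y L'')
        have "sorted_wrt tie (x # y # M) \<longleftrightarrow> tie x y \<and> sorted_wrt tie (y # M)" for M
          using assms by (auto dest: transpD)
        then show ?thesis using Suc Cons L' by (simp del: sorted_wrt.simps)
      qed
    qed (simp add: Suc)
  qed
  then show ?thesis using Suc by simp
qed simp

text \<open>\<open>bad x y z\<close> forbids rows \<open>x\<close> and \<open>y\<close>, in this
  order, in two columns before a column with row \<open>z\<close>. The last assumption is the
  interface to the insertion processes: legality, read off from the list alone, means that a new
  last column \<open>d\<close> at its sorted position completes no bad triple.\<close>

locale scan =
  fixes row_len mult :: "nat \<Rightarrow> nat"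
    and tie :: "nat \<Rightarrow> nat \<Rightarrow> bool" and ok :: "nat \<Rightarrow> nat list \<Rightarrow> bool"
    and bad :: "nat \<Rightarrow> nat \<Rightarrow> nat \<Rightarrow> bool"
  assumes row_len_antimono: "1 \<le> i \<Longrightarrow> i \<le> i' \<Longrightarrow> row_len i' \<le> row_len i"
    and tie_trans: "transp tie" and tie_irrefl: "\<not> tie x x"
    and tie_total: "x \<noteq> y \<Longrightarrow> tie x y \<or> tie y x"
    and ok_iff_not_bad: "\<lbrakk>distinct L; \<forall>x\<in>set L. x < d; sorted_wrt (above tie g) L; j \<le> length L;
        \<forall>x\<in>set (take j L). above tie g x d; \<forall>x\<in>set (drop j L). above tie g d x\<rbrakk>
      \<Longrightarrow> ok j L \<longleftrightarrow> \<not> (\<exists>c1\<in>set L. \<exists>c2\<in>set L. c1 < c2 \<and> bad (g c1) (g c2) (g d))"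
begin

section \<open>Completions of a partial filling, column by column and row by row\<close>

definition columns :: "nat \<Rightarrow> nat list \<Rightarrow> nat set" where
  "columns c L = set L \<union> {c<..row_len 1}"

text \<open>The fillings of the columns in \<open>L\<close> and of those after \<open>c\<close>, given that the rows above \<open>h\<close> are
  complete and that the columns in \<open>L\<close> are arranged in this order.\<close>
definition completions :: "nat \<Rightarrow> nat \<Rightarrow> nat list \<Rightarrow> (nat \<Rightarrow> nat) set" where
  "completions h c L = {g.
     (\<forall>j. j \<notin> columns c L \<longrightarrow> g j = 0) \<and>
     (\<forall>j\<in>columns c L. 1 \<le> g j \<and> g j \<le> h \<and> j \<le> row_len (g j)) \<and>
     (\<forall>i\<in>{1..h}. card {j\<in>columns c L. g j = i} = mult i) \<and>
     sorted_wrt (above tie g) L \<and>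
     (\<forall>c1\<in>columns c L. \<forall>c2\<in>columns c L. \<forall>c3\<in>{c<..row_len 1}.
        c1 < c2 \<and> c2 < c3 \<and> c3 \<le> row_len (max (g c1) (g c2)) \<longrightarrow>
        \<not> bad (g c1) (g c2) (g c3))}"

lemma completionsD:
  assumes "g \<in> completions h c L"
  shows "j \<notin> columns c L \<Longrightarrow> g j = 0"
    and "j \<in> columns c L \<Longrightarrow> 1 \<le> g j \<and> g j \<le> h \<and> j \<le> row_len (g j)"
    and "1 \<le> i \<Longrightarrow> i \<le> h \<Longrightarrow> card {j\<in>columns c L. g j = i} = mult i"
    and "sorted_wrt (above tie g) L"
    and "\<lbrakk>c1 \<in> columns c L; c2 \<in> columns c L; c3 \<in> {c<..row_len 1}; c1 < c2; c2 < c3;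
      c3 \<le> row_len (max (g c1) (g c2))\<rbrakk> \<Longrightarrow> \<not> bad (g c1) (g c2) (g c3)"
  using assms unfolding completions_def mem_Collect_eq by (blast, blast, simp, blast, blast)

lemma finite_completions: "finite (completions h c L)"
proof -
  have "completions h c L \<subseteq>
      {g. \<forall>x. (x \<in> columns c L \<longrightarrow> g x \<in> {..h}) \<and> (x \<notin> columns c L \<longrightarrow> g x = 0)}"
    by (auto simp: completions_def)
  moreover have "finite (columns c L)" by (simp add: columns_def)
  ultimately show ?thesis
    using finite_set_of_finite_funs[of "columns c L" "{..h}" 0] finite_subset by blast
qed

lemma above_trans: "above tie g x y \<Longrightarrow> above tie g y z \<Longrightarrow> above tie g x z"
  using tie_trans by (auto simp: above_def dest: transpD)

lemma above_irrefl: "\<not> above tie g x x"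
  by (simp add: above_def tie_irrefl)

lemma above_total: "x \<noteq> y \<Longrightarrow> above tie g x y \<or> above tie g y x"
  using tie_total by (auto simp: above_def)

lemma above_asym: "above tie g x y \<Longrightarrow> \<not> above tie g y x"
  using above_trans above_irrefl by blast

lemma insertion_exists:
  assumes "sorted_wrt (above tie g) L" "d \<notin> set L"
  obtains j where "j \<le> length L" "sorted_wrt (above tie g) (take j L @ d # drop j L)"
proof -
  have "\<exists>j\<le>length L. sorted_wrt (above tie g) (take j L @ d # drop j L)"
    using assms
  proof (induction L)
    case (Cons x L)
    show ?case
    proof (cases "above tie g d x")
      case True
      then have "sorted_wrt (above tie g) (take 0 (x # L) @ d # drop 0 (x # L))"
        using Cons.prems by (auto intro: above_trans)
      then show ?thesis by blast
    next
      case False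
      then have x: "above tie g x d"
        using above_total[of x d g] Cons.prems by auto
      from Cons obtain j where "j \<le> length L" "sorted_wrt (above tie g) (take j L @ d # drop j L)"
        by auto
      then have "sorted_wrt (above tie g) (take (Suc j) (x # L) @ d # drop (Suc j) (x # L))"
        using x Cons.prems by (auto dest: in_set_takeD in_set_dropD)
      with \<open>j \<le> length L\<close> show ?thesis by (metis Suc_le_mono length_Cons)
    qed
  qed auto
  with that show ?thesis by blast
qed

lemma insertion_unique:
  assumes "j < j'" "j' \<le> length L" "sorted_wrt (above tie g) (take j L @ d # drop j L)"
  shows "\<not> sorted_wrt (above tie g) (take j' L @ d # drop j' L)"
proof
  assume *: "sorted_wrt (above tie g) (take j' L @ d # drop j' L)"
  have "L ! j \<in> set (drop j L)"
    using assms by (metis Cons_nth_drop_Suc dual_order.strict_trans1 list.set_intros(1))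
  moreover have "L ! j \<in> set (take j' L)"
    using assms by (metis in_set_conv_nth length_take min.absorb2 nth_take)
  ultimately show False
    using * assms(3) above_asym by (auto simp: sorted_wrt_append)
qed

text \<open>A filling determines the sorted place of column \<open>Suc c\<close>, and legality of
  that place covers the triples ending in this column. Triples ending later are restricted alike on
  both sides.\<close>

lemma completions_split:
  assumes "1 \<le> h" "c < row_len h" "set L \<subseteq> {1..c}" "distinct L"
  shows "completions h c L =
    (\<Union>j\<in>{j. j \<le> length L \<and> ok j L}. completions h (Suc c) (take j L @ Suc c # drop j L))"
    (is "?A = \<Union> (?B ` ?J)")
proof -
  let ?ins = "\<lambda>j. take j L @ Suc c # drop j L"
  have c: "c < row_len 1"
    using assms row_len_antimono[of 1 h] by simp
  have fresh: "\<forall>x\<in>set L. x < Suc c" using assms by auto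
  have cols: "columns (Suc c) (?ins j) = columns c L" for j
  proof -
    have "set (?ins j) = insert (Suc c) (set (take j L @ drop j L))"
      by (simp only: set_append list.set Un_insert_right)
    then have "set (?ins j) = insert (Suc c) (set L)"
      by (simp only: append_take_drop_id)
    moreover have "{c<..row_len 1} = insert (Suc c) {Suc c<..row_len 1}" using c by auto
    ultimately show ?thesis unfolding columns_def by blast
  qed
  have sorted_ins: "sorted_wrt (above tie g) L" if "sorted_wrt (above tie g) (?ins j)" for g j
  proof -
    have "sorted_wrt (above tie g) (take j L @ drop j L)"
      using that unfolding sorted_wrt_append by simp
    then show ?thesis by (simp only: append_take_drop_id)
  qed
  have ok_iff: "ok j L \<longleftrightarrow>
      \<not> (\<exists>c1\<in>set L. \<exists>c2\<in>set L. c1 < c2 \<and> bad (g c1) (g c2) (g (Suc c)))"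
    if "sorted_wrt (above tie g) (?ins j)" "j \<le> length L" for g j
    using that sorted_ins[OF that(1)] assms fresh
    by (intro ok_iff_not_bad) (auto simp: sorted_wrt_append)
  have step: "{c<..row_len 1} = insert (Suc c) {Suc c<..row_len 1}"
    using c by auto
  have below: "j \<in> set L" if "j \<in> columns c L" "j < Suc c" for j
    using that by (auto simp: columns_def)
  show ?thesis
  proof (intro equalityI subsetI)
    fix g assume g: "g \<in> ?A"
    then have "sorted_wrt (above tie g) L" by (simp add: completions_def)
    then obtain j where j: "j \<le> length L" "sorted_wrt (above tie g) (?ins j)"
      using insertion_exists fresh by blast
    \<comment> \<open>Both rows are at most \<open>h\<close>, and row \<open>h\<close> still reaches
      column \<open>Suc c\<close>, so the triple lies in the shape.\<close>
    have "\<not> bad (g c1) (g c2) (g (Suc c))"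
      if "c1 \<in> set L" "c2 \<in> set L" "c1 < c2" for c1 c2
    proof -
      have "1 \<le> g c1" "g c1 \<le> h" "g c2 \<le> h"
        using g that by (auto simp: completions_def columns_def)
      then have "1 \<le> max (g c1) (g c2)" "max (g c1) (g c2) \<le> h" by auto
      from row_len_antimono[OF this] have "Suc c \<le> row_len (max (g c1) (g c2))"
        using assms(2) by linarith
      then show ?thesis
        using g that fresh c by (auto simp: completions_def columns_def)
    qed
    then have "ok j L" using ok_iff[OF j(2,1)] by blast
    moreover have "g \<in> ?B j"
      using g j(2) unfolding completions_def cols by auto
    ultimately show "g \<in> \<Union> (?B ` ?J)" using j by blast
  next
    fix g assume "g \<in> \<Union> (?B ` ?J)"
    then obtain j where j: "j \<le> length L" "ok j L" and g: "g \<in> ?B j" by blast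
    have s: "sorted_wrt (above tie g) (?ins j)" using g by (simp add: completions_def)
    have "\<not> bad (g c1) (g c2) (g (Suc c))"
      if "c1 \<in> columns c L" "c2 \<in> columns c L" "c1 < c2" "c2 < Suc c" for c1 c2
      using ok_iff[OF s j(1)] j(2) below that by auto
    then show "g \<in> ?A"
      using g sorted_ins[OF s] unfolding completions_def cols step by auto
  qed
qed

lemma card_completions_split:
  assumes "1 \<le> h" "c < row_len h" "set L \<subseteq> {1..c}" "distinct L"
  shows "card (completions h c L) =
    (\<Sum>j | j \<le> length L \<and> ok j L. card (completions h (Suc c) (take j L @ Suc c # drop j L)))"
  unfolding completions_split[OF assms]
proof (rule card_UN_disjoint)
  show "\<forall>i\<in>{j. j \<le> length L \<and> ok j L}. \<forall>j\<in>{j. j \<le> length L \<and> ok j L}. i \<noteq> j \<longrightarrow>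
      completions h (Suc c) (take i L @ Suc c # drop i L) \<inter>
      completions h (Suc c) (take j L @ Suc c # drop j L) = {}"
    using insertion_unique by (auto simp: completions_def) (metis linorder_neqE_nat)
qed (auto simp: finite_completions)

lemma row_is_prefix:
  assumes "sorted_wrt (above tie g) L" "distinct L" "\<forall>x\<in>set L. g x \<le> h"
    "card {x\<in>set L. g x = h} = a"
  shows "a \<le> length L" "{x\<in>set L. g x = h} = set (take a L)"
proof -
  have "a \<le> length L \<and> {x\<in>set L. g x = h} = set (take a L)"
    using assms
  proof (induction L arbitrary: a)
    case (Cons x L)
    show ?case
    proof (cases "g x = h")
      case True
      have eq: "{z\<in>set (x # L). g z = h} = insert x {z\<in>set L. g z = h}" using True by auto
      with Cons.prems have "a = Suc (card {z\<in>set L. g z = h})" by auto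
      then show ?thesis
        using Cons.IH[of "a - 1"] Cons.prems eq by auto
    next
      case False
      then have "\<forall>z\<in>set (x # L). g z \<noteq> h" using Cons.prems by (auto simp: above_def)
      then have "{z\<in>set (x # L). g z = h} = {}" by blast
      then show ?thesis using Cons.prems(4) by (metis card.empty empty_set le0 take0)
    qed
  qed auto
  then show "a \<le> length L" "{x\<in>set L. g x = h} = set (take a L)" by auto
qed

text \<open>Erasing the completed row is a bijection onto the completions of the remaining rows. A
  triple with one of its first two columns in that row imposes no condition, since its last column
  lies beyond the end of the row.\<close>

lemma completions_remove_row:
  assumes "set L \<subseteq> {1..row_len (Suc h)}" "distinct L"
  defines "a \<equiv> mult (Suc h)"
  shows "card (completions (Suc h) (row_len (Suc h)) L) =
    (if a \<le> length L \<and> sorted_wrt tie (take a L)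
     then card (completions h (row_len (Suc h)) (drop a L)) else 0)"
proof -
  let ?c = "row_len (Suc h)"
  let ?T = "set (take a L)" and ?R = "set (drop a L)"
  have set_L: "set L = ?T \<union> ?R" using set_append[of "take a L" "drop a L"] by simp
  have disj: "?T \<inter> ?R = {}" using assms(2) by (simp add: set_take_disj_set_drop_if_distinct)
  have T_le: "\<forall>j\<in>?T. j \<le> ?c" "\<forall>j\<in>?T. 1 \<le> j" using assms(1) set_L by auto
  have cols: "columns ?c L = ?T \<union> columns ?c (drop a L)" "?T \<inter> columns ?c (drop a L) = {}"
    using set_L disj T_le by (auto simp: columns_def)
  have top: "{j\<in>columns ?c L. g j = Suc h} = ?T" "a \<le> length L"
    if "g \<in> completions (Suc h) ?c L" for g
  proof -
    \<comment> \<open>Columns after \<open>?c\<close> do not fit into row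
      \<open>Suc h\<close>.\<close>
    have "j \<in> set L" if "j \<in> columns ?c L" "g j = Suc h" for j
      using completionsD(2)[OF \<open>g \<in> _\<close> that(1)] that by (auto simp: columns_def)
    then have eq: "{j\<in>columns ?c L. g j = Suc h} = {j\<in>set L. g j = Suc h}"
      by (auto simp: columns_def)
    have "card {j\<in>columns ?c L. g j = Suc h} = a"
      using completionsD(3)[OF that, of "Suc h"] by (simp add: a_def)
    moreover have "\<forall>x\<in>set L. g x \<le> Suc h"
      using completionsD(2)[OF that] by (simp add: columns_def)
    ultimately show "{j\<in>columns ?c L. g j = Suc h} = ?T" "a \<le> length L"
      using row_is_prefix[OF completionsD(4)[OF that] assms(2), of "Suc h" a] eq by auto
  qed
  have rows: "\<forall>j\<in>?T. g j = Suc h" if "g \<in> completions (Suc h) ?c L" for g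
    using top(1)[OF that] by blast
  show ?thesis
  proof (cases "a \<le> length L \<and> sorted_wrt tie (take a L)")
    case False
    have "sorted_wrt tie (take a L)" if "g \<in> completions (Suc h) ?c L" for g
    proof -
      have "sorted_wrt (above tie g) (take a L)"
        using completionsD(4)[OF that] by (rule sorted_wrt_take)
      then show ?thesis
        using rows[OF that] by (elim sorted_wrt_mono_rel[rotated]) (auto simp: above_def)
    qed
    with top(2) False have "completions (Suc h) ?c L = {}" by blast
    with False show ?thesis by auto
  next
    case True
    \<comment> \<open>Erased columns get the value 0, which \<open>completions\<close> demands
      outside its columns.\<close>
    let ?f = "\<lambda>g j. if j \<in> ?T then 0 else g j"
    let ?f' = "\<lambda>g j. if j \<in> ?T then Suc h else g j"
    have "bij_betw ?f (completions (Suc h) ?c L) (completions h ?c (drop a L))"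
    proof (rule bij_betw_byWitness[where f' = ?f'])
      show "\<forall>g\<in>completions (Suc h) ?c L. ?f' (?f g) = g"
        proof (intro ballI ext)
        fix g j assume "g \<in> completions (Suc h) ?c L"
        from rows[OF this] show "?f' (?f g) j = g j" by simp
      qed
      show "\<forall>g\<in>completions h ?c (drop a L). ?f (?f' g) = g"
        proof (intro ballI ext)
        fix g j assume "g \<in> completions h ?c (drop a L)"
        from completionsD(1)[OF this, of j] show "?f (?f' g) j = g j" using cols(2) by auto
      qed
      show "?f ` completions (Suc h) ?c L \<subseteq> completions h ?c (drop a L)"
      proof (rule image_subsetI)
        fix g assume g: "g \<in> completions (Suc h) ?c L"
        have ne: "g j \<noteq> Suc h \<and> j \<notin> ?T" if "j \<in> columns ?c (drop a L)" for j
          using top(1)[OF g] that cols by blast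
        have same: "?f g j = g j" if "j \<in> columns ?c (drop a L)" for j
          using ne that by simp
        have gt: "{?c<..row_len 1} \<subseteq> columns ?c (drop a L)" by (auto simp: columns_def)
        have R: "?R \<subseteq> columns ?c (drop a L)" by (auto simp: columns_def)
        have "\<forall>j. j \<notin> columns ?c (drop a L) \<longrightarrow> ?f g j = 0"
          using completionsD(1)[OF g] cols by auto
        moreover have "\<forall>j\<in>columns ?c (drop a L). 1 \<le> ?f g j \<and> ?f g j \<le> h \<and> j \<le> row_len (?f g j)"
        proof
          fix j assume j: "j \<in> columns ?c (drop a L)"
          then have "1 \<le> g j \<and> g j \<le> Suc h \<and> j \<le> row_len (g j)"
            using completionsD(2)[OF g] cols by auto
          then show "1 \<le> ?f g j \<and> ?f g j \<le> h \<and> j \<le> row_len (?f g j)"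
            using ne[OF j] same[OF j] by auto
        qed
        moreover have "card {j\<in>columns ?c (drop a L). ?f g j = i} = mult i" if "i \<in> {1..h}" for i
        proof -
          have "{j\<in>columns ?c (drop a L). ?f g j = i} = {j\<in>columns ?c L. g j = i}"
            using rows[OF g] that cols by fastforce
          then show ?thesis using completionsD(3)[OF g] that by auto
        qed
        moreover have "sorted_wrt (above tie (?f g)) (drop a L)"
        proof -
          have "sorted_wrt (above tie g) (drop a L)"
            using completionsD(4)[OF g] by (rule sorted_wrt_drop)
          then show ?thesis
            using same R by (elim sorted_wrt_mono_rel[rotated]) (auto simp: above_def subset_iff)
        qed
        moreover have "\<not> bad (?f g c1) (?f g c2) (?f g c3)"
          if "c1 \<in> columns ?c (drop a L)" "c2 \<in> columns ?c (drop a L)" "c3 \<in> {?c<..row_len 1}"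
            "c1 < c2 \<and> c2 < c3 \<and> c3 \<le> row_len (max (?f g c1) (?f g c2))" for c1 c2 c3
        proof -
          have "\<not> bad (g c1) (g c2) (g c3)"
            using that cols unfolding same[OF that(1)] same[OF that(2)]
            by (intro completionsD(5)[OF g]) auto
          then show ?thesis
            using same[OF that(1)] same[OF that(2)] same[of c3] that(3) gt by auto
        qed
        ultimately show "?f g \<in> completions h ?c (drop a L)"
          unfolding completions_def by blast
      qed
      show "?f' ` completions h ?c (drop a L) \<subseteq> completions (Suc h) ?c L"
      proof (rule image_subsetI)
        fix g assume g: "g \<in> completions h ?c (drop a L)"
        have le: "1 \<le> g j \<and> g j \<le> h \<and> j \<le> row_len (g j)" "j \<notin> ?T"
          if "j \<in> columns ?c (drop a L)" for j
          using that completionsD(2)[OF g] cols(2) by auto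
        have same: "?f' g j = g j" if "j \<in> columns ?c (drop a L)" for j
          using le that by simp
        have R: "?R \<subseteq> columns ?c (drop a L)" by (auto simp: columns_def)
        have gt: "{?c<..row_len 1} \<subseteq> columns ?c (drop a L)" by (auto simp: columns_def)
        have "\<forall>j. j \<notin> columns ?c L \<longrightarrow> ?f' g j = 0"
          using completionsD(1)[OF g] cols by auto
        moreover have "1 \<le> ?f' g j \<and> ?f' g j \<le> Suc h \<and> j \<le> row_len (?f' g j)"
          if "j \<in> columns ?c L" for j
          using that le[of j] T_le cols by fastforce
        moreover have "card {j\<in>columns ?c L. ?f' g j = i} = mult i" if "i \<in> {1..Suc h}" for i
        proof (cases "i = Suc h")
          case i: True
          have "{j\<in>columns ?c L. ?f' g j = i} = ?T"
            using i cols le(1) by fastforce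
          then show ?thesis
            using True i assms(2) by (simp add: distinct_card a_def)
        next
          case i: False
          have "{j\<in>columns ?c L. ?f' g j = i} = {j\<in>columns ?c (drop a L). g j = i}"
            using i cols by auto
          then show ?thesis using completionsD(3)[OF g] i that by auto
        qed
        moreover have "sorted_wrt (above tie (?f' g)) L"
        proof -
          have 1: "sorted_wrt (above tie (?f' g)) (take a L)"
            using True by (auto simp: above_def elim!: sorted_wrt_mono_rel[rotated])
          have "sorted_wrt (above tie g) (drop a L)"
            by (rule completionsD(4)[OF g])
          then have 2: "sorted_wrt (above tie (?f' g)) (drop a L)"
            using same R by (elim sorted_wrt_mono_rel[rotated]) (auto simp: above_def subset_iff)
          have 3: "above tie (?f' g) x y" if "x \<in> ?T" "y \<in> ?R" for x y
            using that le[of y] R by (auto simp: above_def)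
          have "sorted_wrt (above tie (?f' g)) (take a L @ drop a L)"
            unfolding sorted_wrt_append using 1 2 3 by blast
          then show ?thesis by simp
        qed
        moreover have "\<not> bad (?f' g c1) (?f' g c2) (?f' g c3)"
          if "c1 \<in> columns ?c L" "c2 \<in> columns ?c L" and c3: "c3 \<in> {?c<..row_len 1}"
            and b: "c1 < c2 \<and> c2 < c3 \<and> c3 \<le> row_len (max (?f' g c1) (?f' g c2))" for c1 c2 c3
        proof -
          have small: "g c \<le> Suc h" if "c \<in> columns ?c L" for c
            using le(1)[of c] completionsD(1)[OF g, of c]
            by (cases "c \<in> columns ?c (drop a L)") auto
          have "c1 \<notin> ?T \<and> c2 \<notin> ?T"
          proof (rule ccontr)
            assume "\<not> (c1 \<notin> ?T \<and> c2 \<notin> ?T)"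
            then have "max (?f' g c1) (?f' g c2) = Suc h"
              using small that(1,2) by auto
            with b c3 show False by simp
          qed
          then have c12: "c1 \<in> columns ?c (drop a L)" "c2 \<in> columns ?c (drop a L)"
            using that(1,2) cols by auto
          then have "\<not> bad (g c1) (g c2) (g c3)"
            using b c3 c12 unfolding same[OF c12(1)] same[OF c12(2)]
            by (intro completionsD(5)[OF g]) auto
          then show ?thesis
            using same[OF c12(1)] same[OF c12(2)] same[of c3] c3 gt by auto
        qed
        ultimately show "?f' g \<in> completions (Suc h) ?c L"
          unfolding completions_def by blast
      qed
    qed
    then show ?thesis using True bij_betw_same_card by metis
  qed
qed

section \<open>The border as a sequence of steps\<close>

fun border :: "nat \<Rightarrow> nat \<Rightarrow> step list" where
  "border 0 c = []"
| "border (Suc h) c = map U [Suc c..<Suc (row_len (Suc h))] @ remove_row (mult (Suc h)) @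
    border h (row_len (Suc h))"

lemma fresh_remove_row: "fresh L (remove_row a @ Q) \<longleftrightarrow> fresh L Q"
proof -
  have "fresh L (replicate m Z @ Q') \<longleftrightarrow> fresh L Q'" for m Q'
    by (induction m) auto
  then show ?thesis by (cases a) auto
qed

lemma fresh_map_U:
  assumes "\<forall>x\<in>set L. x < m" "m \<le> k" "\<And>L'. \<forall>x\<in>set L'. x < k \<Longrightarrow> fresh L' Q"
  shows "fresh L (map U [m..<k] @ Q)"
  using assms(2,1,3)
proof (induction m arbitrary: L rule: inc_induct)
  case (step m)
  have "[m..<k] = m # [Suc m..<k]" using step.hyps by (simp add: upt_conv_Cons)
  moreover have "fresh (m # L) (map U [Suc m..<k] @ Q)"
    using step.prems by (intro step.IH) auto
  ultimately show ?case using step.prems(1) by simp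
qed simp

lemma fresh_border:
  assumes "\<forall>x\<in>set L. x \<le> c" "0 < h \<Longrightarrow> c \<le> row_len h"
  shows "fresh L (border h c)"
  using assms
proof (induction h arbitrary: c L)
  case (Suc h)
  have "fresh L' (border h (row_len (Suc h)))" if "\<forall>x\<in>set L'. x < Suc (row_len (Suc h))" for L'
    using that row_len_antimono[of h "Suc h"] by (intro Suc.IH) auto
  then show ?case
    unfolding border.simps using Suc.prems
    by (intro fresh_map_U) (auto simp: fresh_remove_row)
qed simp

text \<open>The outer induction is on the number of remaining rows, the inner one goes backwards
  from the last column of the current row. For \<open>h = 0\<close> the current column has to be
  \<open>row_len 1\<close>, since the locale says nothing about \<open>row_len 0\<close>.\<close>

lemma card_completions:
  assumes "if h = 0 then c = row_len 1 else c \<le> row_len h" "set L \<subseteq> {1..c}" "distinct L"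
  shows "card (completions h c L) = count_ins tie ok (border h c) L"
  using assms
proof (induction h arbitrary: c L)
  case 0
  \<comment> \<open>Without rows there is a filling only if no column is left, and it is constantly
    0.\<close>
  have "completions 0 c L = (if L = [] then {\<lambda>_. 0} else {})"
    using 0 by (cases L) (auto simp: completions_def columns_def)
  then show ?case by simp
next
  case (Suc h)
  define b where "b = row_len (Suc h)"
  have next_row: "if h = 0 then b = row_len 1 else b \<le> row_len h"
    using row_len_antimono[of h "Suc h"] by (auto simp: b_def)
  have "c \<le> b" using Suc.prems by (simp add: b_def)
  from this Suc.prems(2,3) have "card (completions (Suc h) c L) =
    count_ins tie ok (map U [Suc c..<Suc b] @ remove_row (mult (Suc h)) @ border h b) L"
  proof (induction c arbitrary: L rule: inc_induct)
    case base
    have "card (completions h b (drop a L)) = count_ins tie ok (border h b) (drop a L)" for a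
      using base next_row set_drop_subset[of a L] by (intro Suc.IH) auto
    then show ?case
      using completions_remove_row[of L h] base
      by (simp add: b_def count_ins_remove_row[OF tie_trans])
  next
    case (step c)
    have "card (completions (Suc h) (Suc c) (take j L @ Suc c # drop j L)) =
      count_ins tie ok (map U [Suc (Suc c)..<Suc b] @ remove_row (mult (Suc h)) @ border h b)
        (take j L @ Suc c # drop j L)" for j
      using step.prems set_take_subset[of j L] set_drop_subset[of j L]
      by (intro step.IH) (fastforce simp: set_take_disj_set_drop_if_distinct)+
    moreover have "[Suc c..<Suc b] = Suc c # [Suc (Suc c)..<Suc b]"
      using step.hyps by (simp add: upt_conv_Cons)
    ultimately show ?case
      using card_completions_split[of "Suc h" c L] step by (simp add: b_def)
  qed
  then show ?case by (simp add: b_def)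
qed

end

section \<open>Fillings as functions\<close>

text \<open>The value 0 outside the shape turns membership in \<open>cells\<close> into
  inequalities; because of row 0, antitonicity starts at row 1.\<close>

definition row_length :: "nat list \<Rightarrow> nat \<Rightarrow> nat" where
  "row_length lam i = (if 1 \<le> i \<and> i \<le> length lam then lam ! (i - 1) else 0)"

definition row_mult :: "nat list \<Rightarrow> nat \<Rightarrow> nat" where
  "row_mult a i = (if i \<le> length a then a ! (i - 1) else 0)"

text \<open>The weak inequality merges two patterns: 231 for \<open>z < x\<close> and 121 for
  \<open>z = x\<close>. Likewise \<open>bad312\<close> is 312 for \<open>y < z\<close> and 211 for
  \<open>y = z\<close>.\<close>

definition bad231 :: "nat \<Rightarrow> nat \<Rightarrow> nat \<Rightarrow> bool" where
  "bad231 x y z \<longleftrightarrow> z \<le> x \<and> x < y"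

definition bad312 :: "nat \<Rightarrow> nat \<Rightarrow> nat \<Rightarrow> bool" where
  "bad312 x y z \<longleftrightarrow> y \<le> z \<and> z < x"

lemma row_length_antimono:
  assumes "ferrers lam" "1 \<le> i" "i \<le> i'"
  shows "row_length lam i' \<le> row_length lam i"
proof (cases "i = i'")
  case False
  with assms have "i - 1 < i' - 1" by auto
  then show ?thesis
    using assms by (auto simp: row_length_def ferrers_def sorted_wrt_iff_nth_less)
qed simp

lemma cells_iff: "(i, j) \<in> cells lam \<longleftrightarrow> 1 \<le> i \<and> 1 \<le> j \<and> j \<le> row_length lam i"
  by (auto simp: cells_def row_length_def)

lemma ncols_eq: "ncols lam = row_length lam 1"
  by (cases lam) (auto simp: ncols_def row_length_def)

text \<open>The entries in front of \<open>d\<close> are those with row at least \<open>g d\<close>,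
  so both columns of a bad pair stand there, the later and higher one first. Such pairs are exactly
  the inversions of that prefix, as ties are increasing.\<close>

lemma scan_231:
  assumes "ferrers lam"
  shows "scan (row_length lam) (<) ok231 bad231"
proof
  fix L :: "nat list" and d j :: nat and g :: "nat \<Rightarrow> nat"
  assume L: "distinct L" "\<forall>x\<in>set L. x < d" "sorted_wrt (above (<) g) L" "j \<le> length L"
    and up: "\<forall>x\<in>set (take j L). above (<) g x d"
    and down: "\<forall>x\<in>set (drop j L). above (<) g d x"
  have set_L: "set L = set (take j L) \<union> set (drop j L)"
    by (metis append_take_drop_id set_append)
  have sorted: "sorted_wrt (above (<) g) (take j L)"
    using L(3) by (rule sorted_wrt_take)
  show "ok231 j L \<longleftrightarrow> \<not> (\<exists>c1\<in>set L. \<exists>c2\<in>set L. c1 < c2 \<and> bad231 (g c1) (g c2) (g d))"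
  proof
    assume ok: "ok231 j L"
    show "\<not> (\<exists>c1\<in>set L. \<exists>c2\<in>set L. c1 < c2 \<and> bad231 (g c1) (g c2) (g d))"
    proof
      assume "\<exists>c1\<in>set L. \<exists>c2\<in>set L. c1 < c2 \<and> bad231 (g c1) (g c2) (g d)"
      then obtain c1 c2 where c: "c1 \<in> set L" "c2 \<in> set L" "c1 < c2" "g d \<le> g c1" "g c1 < g c2"
        by (auto simp: bad231_def)
      then have "c1 \<in> set (take j L)" "c2 \<in> set (take j L)"
        using down L(2) set_L by (fastforce simp: above_def)+
      then obtain p q where pq: "p < length (take j L)" "take j L ! p = c1"
          "q < length (take j L)" "take j L ! q = c2"
        by (metis in_set_conv_nth)
      have "p < q"
      proof (rule ccontr)
        assume "\<not> p < q"
        moreover have "p \<noteq> q" using pq c(3) by auto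
        ultimately have "q < p" by simp
        with ok pq(1) have "take j L ! q < take j L ! p"
          unfolding ok231_def sorted_wrt_iff_nth_less by blast
        then show False using pq c(3) by simp
      qed
      then have "above (<) g c1 c2"
        using sorted pq unfolding sorted_wrt_iff_nth_less by blast
      then show False using c by (auto simp: above_def)
    qed
  next
    assume no: "\<not> (\<exists>c1\<in>set L. \<exists>c2\<in>set L. c1 < c2 \<and> bad231 (g c1) (g c2) (g d))"
    have "x < y" if "above (<) g x y" "x \<in> set (take j L)" "y \<in> set (take j L)" for x y
    proof (rule ccontr)
      assume "\<not> x < y"
      then have "y < x" "g y < g x" using that by (auto simp: above_def not_less le_less)
      moreover have "g d \<le> g y" using up that by (auto simp: above_def)
      ultimately show False using no that set_L by (auto simp: bad231_def)
    qed
    with sorted show "ok231 j L"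
      unfolding ok231_def by (elim sorted_wrt_mono_rel[rotated])
  qed
qed (use assms row_length_antimono in \<open>auto intro!: transpI\<close>)

text \<open>With ties decreasing, the entries in front of \<open>d\<close> are those with row above
  \<open>g d\<close>. A bad pair thus has its smaller column in front of \<open>d\<close> and its
  larger one behind.\<close>

lemma scan_312:
  assumes "ferrers lam"
  shows "scan (row_length lam) (>) ok312 bad312"
proof
  fix L :: "nat list" and d j :: nat and g :: "nat \<Rightarrow> nat"
  assume L: "distinct L" "\<forall>x\<in>set L. x < d" "sorted_wrt (above (>) g) L" "j \<le> length L"
    and up: "\<forall>x\<in>set (take j L). above (>) g x d"
    and down: "\<forall>x\<in>set (drop j L). above (>) g d x"
  have set_L: "set L = set (take j L) \<union> set (drop j L)"
    by (metis append_take_drop_id set_append)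
  have high: "g d < g x" if "x \<in> set (take j L)" for x
    using up that L(2) by (fastforce simp: above_def dest: in_set_takeD)
  have low: "g x \<le> g d" if "x \<in> set (drop j L)" for x
    using down that by (auto simp: above_def)
  have disj: "set (take j L) \<inter> set (drop j L) = {}"
    using L(1) by (simp add: set_take_disj_set_drop_if_distinct)
  show "ok312 j L \<longleftrightarrow> \<not> (\<exists>c1\<in>set L. \<exists>c2\<in>set L. c1 < c2 \<and> bad312 (g c1) (g c2) (g d))"
  proof
    assume ok: "ok312 j L"
    show "\<not> (\<exists>c1\<in>set L. \<exists>c2\<in>set L. c1 < c2 \<and> bad312 (g c1) (g c2) (g d))"
    proof
      assume "\<exists>c1\<in>set L. \<exists>c2\<in>set L. c1 < c2 \<and> bad312 (g c1) (g c2) (g d)"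
      then obtain c1 c2 where c: "c1 \<in> set L" "c2 \<in> set L" "c1 < c2" "g c2 \<le> g d" "g d < g c1"
        by (auto simp: bad312_def)
      then have "c1 \<in> set (take j L)" "c2 \<in> set (drop j L)"
        using high low set_L by (metis Un_iff leD)+
      then show False using ok c(3) unfolding ok312_def by (metis order.asym)
    qed
  next
    assume no: "\<not> (\<exists>c1\<in>set L. \<exists>c2\<in>set L. c1 < c2 \<and> bad312 (g c1) (g c2) (g d))"
    show "ok312 j L"
      unfolding ok312_def
    proof (intro ballI)
      fix x y assume xy: "x \<in> set (take j L)" "y \<in> set (drop j L)"
      then have "x \<in> set L" "y \<in> set L" by (auto dest: in_set_takeD in_set_dropD)
      then have "\<not> x < y" using no high[OF xy(1)] low[OF xy(2)] by (auto simp: bad312_def)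
      moreover have "x \<noteq> y" using disj xy by auto
      ultimately show "y < x" by simp
    qed
  qed
qed (use assms row_length_antimono in \<open>auto intro!: transpI\<close>)

section \<open>Containment of three-letter words in fillings given by functions\<close>

definition graph :: "nat \<Rightarrow> (nat \<Rightarrow> nat) \<Rightarrow> (nat \<times> nat) set" where
  "graph n g = {(g j, j) | j. j \<in> {1..n}}"

lemma strict_mono_on_1_2: "strict_mono_on {1..2::nat} f \<longleftrightarrow> f 1 < f 2"
  for f :: "nat \<Rightarrow> nat"
proof -
  have "{1..2::nat} = {1, 2}" by auto
  then show ?thesis by (auto simp: strict_mono_on_def)
qed

lemma strict_mono_on_1_3: "strict_mono_on {1..3::nat} f \<longleftrightarrow> f 1 < f 2 \<and> f 2 < f 3"
  for f :: "nat \<Rightarrow> nat"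
proof -
  have "{1..3::nat} = {1, 2, 3}" by auto
  then show ?thesis by (auto simp: strict_mono_on_def)
qed

lemma ball_1_3: "(\<forall>j\<in>{1..3::nat}. P j) \<longleftrightarrow> P 1 \<and> P 2 \<and> P 3"
proof -
  have "{1..3::nat} = {1, 2, 3}" by auto
  then show ?thesis by simp
qed

text \<open>In a Ferrers shape the top right cell of a pattern forces the others to lie in the
  shape. The zeros come for free: each column has a single 1, and \<open>rho\<close> is
  injective.\<close>

lemma contains_graph_iff:
  assumes lam: "ferrers lam" and x: "x \<noteq> []" "\<forall>l\<in>set x. 1 \<le> l"
  shows "contains lam (graph (ncols lam) g) x \<longleftrightarrow>
    (\<exists>rho c. strict_mono_on {1..Max (set x)} rho \<and> strict_mono_on {1..length x} c \<and>
      1 \<le> rho 1 \<and> 1 \<le> c 1 \<and> (rho (Max (set x)), c (length x)) \<in> cells lam \<and>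
      (\<forall>j\<in>{1..length x}. g (c j) = rho (x ! (j - 1))))"
  (is "?L \<longleftrightarrow> (\<exists>rho c. ?R rho c)")
proof -
  let ?M = "Max (set x)" and ?r = "length x"
  have r: "1 \<le> ?r" using x(1) by (cases x) auto
  have letter: "x ! (j - 1) \<in> {1..?M}" if "j \<in> {1..?r}" for j
  proof -
    have "x ! (j - 1) \<in> set x" using that by (intro nth_mem) auto
    then show ?thesis using x(2) by auto
  qed
  from letter[of 1] have M: "1 \<le> ?M" using r by auto
  show ?thesis
  proof
    assume ?L
    then obtain rho c where *: "strict_mono_on {1..?M} rho" "strict_mono_on {1..?r} c"
      "\<And>l j. l \<in> {1..?M} \<Longrightarrow> j \<in> {1..?r} \<Longrightarrow> (rho l, c j) \<in> cells lam"
      "\<And>l j. l \<in> {1..?M} \<Longrightarrow> j \<in> {1..?r} \<Longrightarrow>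
        (rho l, c j) \<in> graph (ncols lam) g \<longleftrightarrow> x ! (j - 1) = l"
      unfolding contains_def Let_def by blast
    have "g (c j) = rho (x ! (j - 1))" if "j \<in> {1..?r}" for j
      using *(4)[OF letter[OF that] that] by (auto simp: graph_def)
    moreover have "(rho 1, c 1) \<in> cells lam" "(rho ?M, c ?r) \<in> cells lam"
      using *(3)[of 1 1] *(3)[of ?M ?r] M r by auto
    ultimately have "?R rho c"
      using *(1,2) by (simp add: cells_iff)
    then show "\<exists>rho c. ?R rho c" by blast
  next
    assume "\<exists>rho c. ?R rho c"
    then obtain rho c where *: "?R rho c" by blast
    then have rho: "strict_mono_on {1..?M} rho" and c: "strict_mono_on {1..?r} c" by blast+
    have base: "1 \<le> rho 1" "1 \<le> c 1" "c ?r \<le> row_length lam (rho ?M)"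
      using * by (simp_all add: cells_iff)
    have cell: "(rho l, c j) \<in> cells lam" if "l \<in> {1..?M}" "j \<in> {1..?r}" for l j
    proof -
      have "rho 1 \<le> rho l" "rho l \<le> rho ?M" "c 1 \<le> c j" "c j \<le> c ?r"
        using that M r strict_mono_on_leD[OF rho] strict_mono_on_leD[OF c] by auto
      then show ?thesis
        using base row_length_antimono[OF lam, of "rho l" "rho ?M"] unfolding cells_iff by linarith
    qed
    have "(rho l, c j) \<in> graph (ncols lam) g \<longleftrightarrow> x ! (j - 1) = l"
      if "l \<in> {1..?M}" "j \<in> {1..?r}" for l j
    proof -
      have "c j \<in> {1..ncols lam}"
        using cell[OF that] row_length_antimono[OF lam, of 1 "rho l"]
        unfolding cells_iff ncols_eq by auto
      then have "(rho l, c j) \<in> graph (ncols lam) g \<longleftrightarrow> rho l = rho (x ! (j - 1))"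
        using * that by (auto simp: graph_def)
      also have "\<dots> \<longleftrightarrow> l = x ! (j - 1)"
        using strict_mono_on_imp_inj_on[OF rho] letter[OF that(2)] that(1) by (auto dest: inj_onD)
      finally show ?thesis by auto
    qed
    with cell rho c show ?L unfolding contains_def Let_def by blast
  qed
qed

text \<open>In all four words the largest letter is among the first two, so the row
  \<open>max (g c1) (g c2)\<close> and the column \<open>c3\<close> meet in the top right cell of
  the pattern.\<close>

definition bad_triple :: "nat list \<Rightarrow> (nat \<Rightarrow> nat \<Rightarrow> nat \<Rightarrow> bool) \<Rightarrow> (nat \<Rightarrow> nat) \<Rightarrow> bool" where
  "bad_triple lam bad g \<longleftrightarrow> (\<exists>c1 c2 c3. 1 \<le> c1 \<and> c1 < c2 \<and> c2 < c3 \<and>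
     c3 \<le> row_length lam (max (g c1) (g c2)) \<and> bad (g c1) (g c2) (g c3))"

lemma contains_graph_3:
  assumes "ferrers lam" "Max {x, y, z} = 3" "1 \<le> x" "1 \<le> y" "1 \<le> z"
  shows "contains lam (graph (ncols lam) g) [x, y, z] \<longleftrightarrow>
    (\<exists>(rho :: nat \<Rightarrow> nat) (c :: nat \<Rightarrow> nat). rho 1 < rho 2 \<and> rho 2 < rho 3 \<and> c 1 < c 2 \<and> c 2 < c 3 \<and> 1 \<le> rho 1 \<and> 1 \<le> c 1 \<and>
      c 3 \<le> row_length lam (rho 3) \<and> g (c 1) = rho x \<and> g (c 2) = rho y \<and> g (c 3) = rho z)"
  (is "_ \<longleftrightarrow> ?rhs")
proof -
  have M: "Max (set [x, y, z]) = 3" and len: "length [x, y, z] = 3" using assms(2) by simp_all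
  have nth: "[x, y, z] ! (1 - 1) = x" "[x, y, z] ! (2 - 1) = y" "[x, y, z] ! (3 - 1) = z"
    by simp_all
  have "contains lam (graph (ncols lam) g) [x, y, z] \<longleftrightarrow>
    (\<exists>(rho :: nat \<Rightarrow> nat) (c :: nat \<Rightarrow> nat). (rho 1 < rho 2 \<and> rho 2 < rho 3) \<and> (c 1 < c 2 \<and> c 2 < c 3) \<and>
      1 \<le> rho 1 \<and> 1 \<le> c 1 \<and> (1 \<le> rho 3 \<and> 1 \<le> c 3 \<and> c 3 \<le> row_length lam (rho 3)) \<and>
      g (c 1) = rho x \<and> g (c 2) = rho y \<and> g (c 3) = rho z)"
    using contains_graph_iff[OF assms(1), of "[x, y, z]" g] assms(3-5)
    unfolding M len strict_mono_on_1_3 ball_1_3 cells_iff nth by (simp only: list.set) simp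
  also have "\<dots> \<longleftrightarrow> ?rhs"
    by (intro ex_cong1) auto
  finally show ?thesis .
qed

lemma contains_graph_2:
  assumes "ferrers lam" "Max {x, y, z} = 2" "1 \<le> x" "1 \<le> y" "1 \<le> z"
  shows "contains lam (graph (ncols lam) g) [x, y, z] \<longleftrightarrow>
    (\<exists>(rho :: nat \<Rightarrow> nat) (c :: nat \<Rightarrow> nat). rho 1 < rho 2 \<and> c 1 < c 2 \<and> c 2 < c 3 \<and> 1 \<le> rho 1 \<and> 1 \<le> c 1 \<and>
      c 3 \<le> row_length lam (rho 2) \<and> g (c 1) = rho x \<and> g (c 2) = rho y \<and> g (c 3) = rho z)"
  (is "_ \<longleftrightarrow> ?rhs")
proof -
  have M: "Max (set [x, y, z]) = 2" and len: "length [x, y, z] = 3" using assms(2) by simp_all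
  have nth: "[x, y, z] ! (1 - 1) = x" "[x, y, z] ! (2 - 1) = y" "[x, y, z] ! (3 - 1) = z"
    by simp_all
  have "contains lam (graph (ncols lam) g) [x, y, z] \<longleftrightarrow>
    (\<exists>(rho :: nat \<Rightarrow> nat) (c :: nat \<Rightarrow> nat). rho 1 < rho 2 \<and> (c 1 < c 2 \<and> c 2 < c 3) \<and>
      1 \<le> rho 1 \<and> 1 \<le> c 1 \<and> (1 \<le> rho 2 \<and> 1 \<le> c 3 \<and> c 3 \<le> row_length lam (rho 2)) \<and>
      g (c 1) = rho x \<and> g (c 2) = rho y \<and> g (c 3) = rho z)"
    using contains_graph_iff[OF assms(1), of "[x, y, z]" g] assms(3-5)
    unfolding M len strict_mono_on_1_3 strict_mono_on_1_2 ball_1_3 cells_iff nth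
    by (simp only: list.set) simp
  also have "\<dots> \<longleftrightarrow> ?rhs"
    by (intro ex_cong1) auto
  finally show ?thesis .
qed

lemma ex_patternI:
  fixes P :: "(nat \<Rightarrow> nat) \<Rightarrow> (nat \<Rightarrow> nat) \<Rightarrow> bool"
  assumes "P (\<lambda>l. if l = 1 then r else if l = 2 then s else t)
             (\<lambda>j. if j = 1 then u else if j = 2 then v else w)"
  shows "\<exists>rho c. P rho c"
  using assms by blast

text \<open>A bad triple gives 121 if its outer columns share a row and 231 otherwise. Positivity of
  \<open>g\<close> puts the lowest row of the pattern into the shape.\<close>

lemma contains_231_121:
  assumes "ferrers lam" and pos: "\<forall>j\<in>{1..ncols lam}. 1 \<le> g j"
  shows "contains lam (graph (ncols lam) g) [2,3,1] \<or> contains lam (graph (ncols lam) g) [1,2,1]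
    \<longleftrightarrow> bad_triple lam bad231 g"
proof -
  have A: "contains lam (graph (ncols lam) g) [2,3,1] \<longleftrightarrow>
    (\<exists>(rho :: nat \<Rightarrow> nat) (c :: nat \<Rightarrow> nat). rho 1 < rho 2 \<and> rho 2 < rho 3 \<and> c 1 < c 2 \<and> c 2 < c 3 \<and> 1 \<le> rho 1 \<and> 1 \<le> c 1 \<and>
      c 3 \<le> row_length lam (rho 3) \<and> g (c 1) = rho 2 \<and> g (c 2) = rho 3 \<and> g (c 3) = rho 1)"
    by (intro contains_graph_3 assms) auto
  have B: "contains lam (graph (ncols lam) g) [1,2,1] \<longleftrightarrow>
    (\<exists>(rho :: nat \<Rightarrow> nat) (c :: nat \<Rightarrow> nat). rho 1 < rho 2 \<and> c 1 < c 2 \<and> c 2 < c 3 \<and> 1 \<le> rho 1 \<and> 1 \<le> c 1 \<and>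
      c 3 \<le> row_length lam (rho 2) \<and> g (c 1) = rho 1 \<and> g (c 2) = rho 2 \<and> g (c 3) = rho 1)"
    by (intro contains_graph_2 assms) auto
  show ?thesis
    unfolding A B
  proof (intro iffI; (elim disjE exE conjE)?)
    fix rho c :: "nat \<Rightarrow> nat"
    assume "rho 1 < rho 2" "rho 2 < rho 3" "c 1 < c 2" "c 2 < c 3"
      "1 \<le> c 1" "c 3 \<le> row_length lam (rho 3)" "g (c 1) = rho 2" "g (c 2) = rho 3" "g (c 3) = rho 1"
    then show "bad_triple lam bad231 g"
      unfolding bad_triple_def bad231_def
      by (intro exI[of _ "c 1"] exI[of _ "c 2"] exI[of _ "c 3"]) (simp add: max_def)
  next
    fix rho c :: "nat \<Rightarrow> nat"
    assume "rho 1 < rho 2" "c 1 < c 2" "c 2 < c 3"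
      "1 \<le> c 1" "c 3 \<le> row_length lam (rho 2)" "g (c 1) = rho 1" "g (c 2) = rho 2" "g (c 3) = rho 1"
    then show "bad_triple lam bad231 g"
      unfolding bad_triple_def bad231_def
      by (intro exI[of _ "c 1"] exI[of _ "c 2"] exI[of _ "c 3"]) (simp add: max_def)
  next
    assume "bad_triple lam bad231 g"
    then obtain c1 c2 c3 where c: "1 \<le> c1" "c1 < c2" "c2 < c3"
      "c3 \<le> row_length lam (g c2)" "g c3 \<le> g c1" "g c1 < g c2"
      by (auto simp: bad_triple_def bad231_def max_def split: if_splits)
    have "c3 \<le> ncols lam"
      using c row_length_antimono[OF assms(1), of 1 "g c2"] by (auto simp: ncols_eq)
    then have g3: "1 \<le> g c3" using c pos by auto
    show "(\<exists>(rho :: nat \<Rightarrow> nat) (c :: nat \<Rightarrow> nat). rho 1 < rho 2 \<and> rho 2 < rho 3 \<and> c 1 < c 2 \<and> c 2 < c 3 \<and> 1 \<le> rho 1 \<and> 1 \<le> c 1 \<and>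
        c 3 \<le> row_length lam (rho 3) \<and> g (c 1) = rho 2 \<and> g (c 2) = rho 3 \<and> g (c 3) = rho 1) \<or>
      (\<exists>(rho :: nat \<Rightarrow> nat) (c :: nat \<Rightarrow> nat). rho 1 < rho 2 \<and> c 1 < c 2 \<and> c 2 < c 3 \<and> 1 \<le> rho 1 \<and> 1 \<le> c 1 \<and>
        c 3 \<le> row_length lam (rho 2) \<and> g (c 1) = rho 1 \<and> g (c 2) = rho 2 \<and> g (c 3) = rho 1)"
    proof (cases "g c3 = g c1")
      case True
      \<comment> \<open>A two-letter word uses only \<open>rho 1\<close> and \<open>rho 2\<close>;
        the value 0 for \<open>t\<close> is a filler.\<close>
      show ?thesis
        by (rule disjI2, rule ex_patternI[where r = "g c1" and s = "g c2" and t = 0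
              and u = c1 and v = c2 and w = c3]) (use c True g3 in simp)
    next
      case False
      show ?thesis
        by (rule disjI1, rule ex_patternI[where r = "g c3" and s = "g c1" and t = "g c2"
              and u = c1 and v = c2 and w = c3]) (use c False g3 in simp)
    qed
  qed
qed

lemma contains_312_211:
  assumes "ferrers lam" and pos: "\<forall>j\<in>{1..ncols lam}. 1 \<le> g j"
  shows "contains lam (graph (ncols lam) g) [3,1,2] \<or> contains lam (graph (ncols lam) g) [2,1,1]
    \<longleftrightarrow> bad_triple lam bad312 g"
proof -
  have A: "contains lam (graph (ncols lam) g) [3,1,2] \<longleftrightarrow>
    (\<exists>(rho :: nat \<Rightarrow> nat) (c :: nat \<Rightarrow> nat). rho 1 < rho 2 \<and> rho 2 < rho 3 \<and> c 1 < c 2 \<and> c 2 < c 3 \<and> 1 \<le> rho 1 \<and> 1 \<le> c 1 \<and>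
      c 3 \<le> row_length lam (rho 3) \<and> g (c 1) = rho 3 \<and> g (c 2) = rho 1 \<and> g (c 3) = rho 2)"
    by (intro contains_graph_3 assms) auto
  have B: "contains lam (graph (ncols lam) g) [2,1,1] \<longleftrightarrow>
    (\<exists>(rho :: nat \<Rightarrow> nat) (c :: nat \<Rightarrow> nat). rho 1 < rho 2 \<and> c 1 < c 2 \<and> c 2 < c 3 \<and> 1 \<le> rho 1 \<and> 1 \<le> c 1 \<and>
      c 3 \<le> row_length lam (rho 2) \<and> g (c 1) = rho 2 \<and> g (c 2) = rho 1 \<and> g (c 3) = rho 1)"
    by (intro contains_graph_2 assms) auto
  show ?thesis
    unfolding A B
  proof (intro iffI; (elim disjE exE conjE)?)
    fix rho c :: "nat \<Rightarrow> nat"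
    assume "rho 1 < rho 2" "rho 2 < rho 3" "c 1 < c 2" "c 2 < c 3"
      "1 \<le> c 1" "c 3 \<le> row_length lam (rho 3)" "g (c 1) = rho 3" "g (c 2) = rho 1" "g (c 3) = rho 2"
    then show "bad_triple lam bad312 g"
      unfolding bad_triple_def bad312_def
      by (intro exI[of _ "c 1"] exI[of _ "c 2"] exI[of _ "c 3"]) (simp add: max_def)
  next
    fix rho c :: "nat \<Rightarrow> nat"
    assume "rho 1 < rho 2" "c 1 < c 2" "c 2 < c 3"
      "1 \<le> c 1" "c 3 \<le> row_length lam (rho 2)" "g (c 1) = rho 2" "g (c 2) = rho 1" "g (c 3) = rho 1"
    then show "bad_triple lam bad312 g"
      unfolding bad_triple_def bad312_def
      by (intro exI[of _ "c 1"] exI[of _ "c 2"] exI[of _ "c 3"]) (simp add: max_def)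
  next
    assume "bad_triple lam bad312 g"
    then obtain c1 c2 c3 where c: "1 \<le> c1" "c1 < c2" "c2 < c3"
      "c3 \<le> row_length lam (g c1)" "g c2 \<le> g c3" "g c3 < g c1"
      by (auto simp: bad_triple_def bad312_def max_def split: if_splits)
    have "c3 \<le> ncols lam"
      using c row_length_antimono[OF assms(1), of 1 "g c1"] by (auto simp: ncols_eq)
    then have g2: "1 \<le> g c2" using c pos by auto
    show "(\<exists>(rho :: nat \<Rightarrow> nat) (c :: nat \<Rightarrow> nat). rho 1 < rho 2 \<and> rho 2 < rho 3 \<and> c 1 < c 2 \<and> c 2 < c 3 \<and> 1 \<le> rho 1 \<and> 1 \<le> c 1 \<and>
        c 3 \<le> row_length lam (rho 3) \<and> g (c 1) = rho 3 \<and> g (c 2) = rho 1 \<and> g (c 3) = rho 2) \<or>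
      (\<exists>(rho :: nat \<Rightarrow> nat) (c :: nat \<Rightarrow> nat). rho 1 < rho 2 \<and> c 1 < c 2 \<and> c 2 < c 3 \<and> 1 \<le> rho 1 \<and> 1 \<le> c 1 \<and>
        c 3 \<le> row_length lam (rho 2) \<and> g (c 1) = rho 2 \<and> g (c 2) = rho 1 \<and> g (c 3) = rho 1)"
    proof (cases "g c2 = g c3")
      case True
      show ?thesis
        by (rule disjI2, rule ex_patternI[where r = "g c2" and s = "g c1" and t = 0
              and u = c1 and v = c2 and w = c3]) (use c True g2 in simp)
    next
      case False
      show ?thesis
        by (rule disjI1, rule ex_patternI[where r = "g c2" and s = "g c3" and t = "g c1"
              and u = c1 and v = c2 and w = c3]) (use c False g2 in simp)
    qed
  qed
qed

text \<open>A positive multiplicity above the top row cannot be met, so there are no fillings then.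
  Otherwise \<open>graph\<close> is a bijection from the completions of the empty list, before any
  column is inserted, onto the fillings.\<close>

lemma card_W:
  assumes "ferrers lam"
    and scan: "scan (row_length lam) tie ok bad"
    and contains: "\<And>g. \<forall>j\<in>{1..ncols lam}. 1 \<le> g j \<Longrightarrow>
      (\<exists>x\<in>Omega. contains lam (graph (ncols lam) g) x) \<longleftrightarrow> bad_triple lam bad g"
  shows "card (W lam a Omega) =
    (if \<forall>i>length lam. row_mult a i = 0
     then count_ins tie ok (scan.border (row_length lam) (row_mult a) (length lam) 0) [] else 0)"
proof (cases "\<forall>i>length lam. row_mult a i = 0")
  case False
  then obtain i where i: "length lam < i" "row_mult a i \<noteq> 0" by blast
  have "F \<notin> W lam a Omega" for F
  proof
    assume "F \<in> W lam a Omega"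
    then have F: "F \<subseteq> cells lam" and "\<forall>i\<ge>1. card {j. (i, j) \<in> F} = row_mult a i"
      by (auto simp: W_def row_mult_def)
    then have "card {j. (i, j) \<in> F} \<noteq> 0" using i by auto
    then obtain j where "(i, j) \<in> F" by (metis (no_types, lifting) card.empty empty_Collect_eq)
    then show False using F i(1) by (auto simp: cells_def)
  qed
  then have "W lam a Omega = {}" by blast
  with False show ?thesis by auto
next
  case True
  interpret scan "row_length lam" "row_mult a" tie ok bad by (rule scan)
  let ?n = "ncols lam" and ?C = "completions (length lam) 0 []"
  have cols: "columns 0 [] = {1..?n}"
    by (auto simp: columns_def ncols_eq)
  have C: "g \<in> ?C \<longleftrightarrow> (\<forall>j. j \<notin> {1..?n} \<longrightarrow> g j = 0) \<and> (\<forall>j\<in>{1..?n}. (g j, j) \<in> cells lam) \<and>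
      (\<forall>i\<ge>1. card {j\<in>{1..?n}. g j = i} = row_mult a i) \<and> \<not> bad_triple lam bad g"
    (is "_ \<longleftrightarrow> ?zero \<and> ?cells \<and> ?mult \<and> _") for g
  proof -
    have cell: "(\<forall>j\<in>{1..?n}. 1 \<le> g j \<and> g j \<le> length lam \<and> j \<le> row_length lam (g j)) \<longleftrightarrow> ?cells"
      by (auto simp: cells_iff row_length_def split: if_splits)
    have mult: "(\<forall>i\<in>{1..length lam}. card {j\<in>{1..?n}. g j = i} = row_mult a i) \<longleftrightarrow> ?mult" if ?cells
    proof -
      have "card {j\<in>{1..?n}. g j = i} = row_mult a i" if "length lam < i" for i
      proof -
        have empty: "{j\<in>{1..?n}. g j = i} = {}" using \<open>?cells\<close> that by (fastforce simp: cells_def)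
        show ?thesis unfolding empty using True that by simp
      qed
      then show ?thesis by (metis atLeastAtMost_iff linorder_not_le)
    qed
    have "c3 \<le> ?n" if "c3 \<le> row_length lam m" for c3 m
      using that row_length_antimono[OF assms(1), of 1 m]
      by (cases "m = 0") (auto simp: ncols_eq row_length_def)
    then have triple: "(\<forall>c1\<in>{1..?n}. \<forall>c2\<in>{1..?n}. \<forall>c3\<in>{0<..row_length lam 1}.
        c1 < c2 \<and> c2 < c3 \<and> c3 \<le> row_length lam (max (g c1) (g c2)) \<longrightarrow>
        \<not> bad (g c1) (g c2) (g c3)) \<longleftrightarrow> \<not> bad_triple lam bad g"
      unfolding bad_triple_def ncols_eq by fastforce
    show ?thesis
      unfolding completions_def cols mem_Collect_eq cell triple using mult by auto
  qed
  have mem_graph: "(i, j) \<in> graph ?n g \<longleftrightarrow> j \<in> {1..?n} \<and> g j = i" for i j g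
    by (auto simp: graph_def)
  have W_iff: "graph ?n g \<in> W lam a Omega \<longleftrightarrow> g \<in> ?C" if zero: "\<forall>j. j \<notin> {1..?n} \<longrightarrow> g j = 0" for g
  proof -
    have "graph ?n g \<subseteq> cells lam \<longleftrightarrow> (\<forall>j\<in>{1..?n}. (g j, j) \<in> cells lam)"
      by (auto simp: graph_def)
    moreover have "card {i. (i, j) \<in> graph ?n g} = 1" if "j \<in> {1..?n}" for j
    proof -
      have "{i. (i, j) \<in> graph ?n g} = {g j}" using that by (auto simp: mem_graph)
      then show ?thesis by simp
    qed
    moreover have "{j. (i, j) \<in> graph ?n g} = {j\<in>{1..?n}. g j = i}" for i
      by (auto simp: mem_graph)
    moreover have "(\<forall>x\<in>Omega. \<not> contains lam (graph ?n g) x) \<longleftrightarrow> \<not> bad_triple lam bad g"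
      if "\<forall>j\<in>{1..?n}. (g j, j) \<in> cells lam"
      using contains[of g] that by (auto simp: cells_iff)
    ultimately show ?thesis
      unfolding C W_def mem_Collect_eq row_mult_def[symmetric] using zero by auto
  qed
  have "bij_betw (graph ?n) ?C (W lam a Omega)"
  proof (rule bij_betw_imageI)
    show "inj_on (graph ?n) ?C"
    proof (intro inj_onI ext)
      fix g g' j assume "g \<in> ?C" "g' \<in> ?C" and eq: "graph ?n g = graph ?n g'"
      then show "g j = g' j"
        using mem_graph[of "g j" j g] mem_graph[of "g j" j g'] C by (cases "j \<in> {1..?n}") auto
    qed
    show "graph ?n ` ?C = W lam a Omega"
    proof (intro equalityI subsetI)
      fix F assume F: "F \<in> W lam a Omega"
      \<comment> \<open>The row of the single 1 in each column; the value 0 elsewhere is the default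
        in \<open>completions\<close>.\<close>
      define g where "g j = (if j \<in> {1..?n} then THE i. (i, j) \<in> F else 0)" for j
      have unique: "(i, j) \<in> F \<longleftrightarrow> i = g j" if "j \<in> {1..?n}" for i j
      proof -
        have "card {i. (i, j) \<in> F} = 1" using F that by (simp add: W_def)
        then obtain i0 where "{i. (i, j) \<in> F} = {i0}" by (auto simp: card_1_singleton_iff)
        then have "(i, j) \<in> F \<longleftrightarrow> i = i0" for i by auto
        then show ?thesis using that by (simp add: g_def)
      qed
      have "j \<in> {1..?n}" if "(i, j) \<in> F" for i j
      proof -
        have "(i, j) \<in> cells lam" using F that by (auto simp: W_def)
        then show ?thesis
          using row_length_antimono[OF assms(1), of 1 i] by (auto simp: cells_iff ncols_eq)
      qed
      then have "p \<in> F \<longleftrightarrow> p \<in> graph ?n g" for p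
        by (cases p) (metis unique mem_graph)
      then have "F = graph ?n g" by blast
      then show "F \<in> graph ?n ` ?C" using W_iff[of g] F by (auto simp: g_def)
    next
      fix F assume "F \<in> graph ?n ` ?C"
      then show "F \<in> W lam a Omega" using W_iff C by auto
    qed
  qed
  then have "card (W lam a Omega) = card ?C" by (metis bij_betw_same_card)
  also have "\<dots> = count_ins tie ok (border (length lam) 0) []"
    by (rule card_completions) (auto simp: row_length_def)
  finally show ?thesis using True by simp
qed

theorem theorem15:
  fixes lam a :: "nat list"
  assumes "ferrers lam"
    and "\<forall>k\<in>set a. 0 < k"
  shows "card (W lam a {[2,3,1], [1,2,1]}) = card (W lam a {[3,1,2], [2,1,1]})"
proof -
  \<comment> \<open>The border depends only on row lengths and multiplicities, so the same steps
    serve both pattern sets.\<close>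
  let ?Q = "scan.border (row_length lam) (row_mult a) (length lam) 0"
  interpret scan "row_length lam" "row_mult a" "(<)" ok231 bad231
    by (rule scan_231) fact
  have fresh: "fresh [] ?Q" by (rule fresh_border) auto
  have "card (W lam a {[2,3,1], [1,2,1]}) =
    (if \<forall>i>length lam. row_mult a i = 0 then count_ins (<) ok231 ?Q [] else 0)"
    by (rule card_W[OF assms(1) scan_231[OF assms(1)]]) (use contains_231_121[OF assms(1)] in simp)
  moreover have "card (W lam a {[3,1,2], [2,1,1]}) =
    (if \<forall>i>length lam. row_mult a i = 0 then count_ins (>) ok312 ?Q [] else 0)"
    by (rule card_W[OF assms(1) scan_312[OF assms(1)]]) (use contains_312_211[OF assms(1)] in simp)
  ultimately show ?thesis
    using count_ins_231_eq_312[OF fresh] by (simp only:)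
qed

end
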